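(* Let $(G_n)$ be a sequence of finite $(q_n+1)$-regular graphs $G_n=(V_n,E_n)$, $q_n\in\mathbb{N}^+$, with normalized spectral measures $\mu_n=\mu(G_n)$. The following are equivalent: (i) for every $p\in[1,\infty)$, $W_p(\mu_n,\mu_\infty)\to0$; (ii) for every $p\in[1,\infty)$, $F^{-1}_{\mu_n}\to F^{-1}_{\mu_\infty}$ in $L^p[0,1]$; (iii) $\mu_n$ converges in moments to $\mu_\infty$, i.e. $\int P\,d\mu_n\to\int P\,d\mu_\infty$ for every polynomial $P$; (iv) $q_n\to\infty$ and for every $r\ge1$, $q_n^{-r/2}c_r(G_n)/|V_n|\to0$; (v) $q_n\to\infty$ and for every $r\ge1$, $q_n^{-r/2}f_r(G_n)/|V_n|\to0$.
   Context: Graphs may have multi-edges and loops; each edge gives two mutually inverse directed edges $e,\overline e$; adjacency $A_{ab}$ = number of directed edges from $a$ to $b$; $(q+1)$-regular: each vertex is the origin of $q+1$ directed edges. $\mu(G)=\frac1{|V|}\sum_k\delta_{q^{-1/2}\lambda_k(A)}$ (with $q=q_n$). A walk of length $r$ is a sequence of directed edges $e_0,\dots,e_{r-1}$ with $t(e_i)=o(e_{i+1})$; closed if it returns to its start; non-backtracking if $e_{i+1}\ne\overline{e_i}$ for all $i$. $f_r(G)$ = number of closed non-backtracking walks of length $r$ (over all starting vertices); a circuit is a closed non-backtracking walk of length $r\ge1$ with also $e_0\ne\overline{e_{r-1}}$; $c_r(G)$ = number of circuits of length $r$. Semicircle $d\mu_\infty=\frac1{2\pi}\sqrt{4-x^2}\mathbf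 1_{|x|\le2}dx$. $W_p(\mu,\nu)=\inf_\gamma(\int|x-y|^pd\gamma)^{1/p}$ over couplings. $F^{-1}_\mu(x)=\inf\{y:\mu((-\infty,y])\ge x\}$. *)

theory Defs
  imports "HOL-Probability.Probability" "Graph_Theory.Graph_Theory" "Jordan_Normal_Form.Char_Poly"
begin

text \<open>Graphs: a graph with multi-edges and loops is a finite digraph G (record of the
Graph_Theory AFP entry: verts, arcs, tail = origin, head = terminus) together with a
fixed-point-free involution arev on the directed edges (the inversion e to e-bar) with
tail (arev e) = head e; this is the locale bidirected_digraph.\<close>

definition adj_count :: "('v,'e) pre_digraph \<Rightarrow> 'v \<Rightarrow> 'v \<Rightarrow> nat" where
  "adj_count G a b = card {e \<in> arcs G. tail G e = a \<and> head G e = b}"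

definition regular_deg :: "('v,'e) pre_digraph \<Rightarrow> nat \<Rightarrow> bool" where
  "regular_deg G d \<longleftrightarrow> (\<forall>v \<in> verts G. card {e \<in> arcs G. tail G e = v} = d)"

definition vert_enum :: "('v,'e) pre_digraph \<Rightarrow> nat \<Rightarrow> 'v" where
  "vert_enum G = (SOME f. bij_betw f {0..<card (verts G)} (verts G))"

definition adj_mat :: "('v,'e) pre_digraph \<Rightarrow> real mat" where
  "adj_mat G = Matrix.mat (card (verts G)) (card (verts G))
     (\<lambda>(i,j). real (adj_count G (vert_enum G i) (vert_enum G j)))"

definition adj_eigs :: "('v,'e) pre_digraph \<Rightarrow> real multiset" where
  "adj_eigs G = proots (char_poly (adj_mat G))"

definition spectral_measure :: "nat \<Rightarrow> ('v,'e) pre_digraph \<Rightarrow> real measure" where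
  "spectral_measure q G =
     distr (measure_pmf (pmf_of_multiset (image_mset (\<lambda>x. x / sqrt (real q)) (adj_eigs G))))
       borel (\<lambda>x. x)"

definition semicircle :: "real measure" where
  "semicircle = density lborel
     (\<lambda>x. ennreal (indicator {-2..2} x * sqrt (4 - x\<^sup>2) / (2 * pi)))"

definition closed_nb_walks :: "('v,'e) pre_digraph \<Rightarrow> ('e \<Rightarrow> 'e) \<Rightarrow> nat \<Rightarrow> 'e list set" where
  "closed_nb_walks G arev r = {p. length p = r \<and> (\<exists>u. pre_digraph.awalk G u p u) \<and>
      (\<forall>i. Suc i < r \<longrightarrow> p ! Suc i \<noteq> arev (p ! i))}"

definition f_count :: "('v,'e) pre_digraph \<Rightarrow> ('e \<Rightarrow> 'e) \<Rightarrow> nat \<Rightarrow> nat" where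
  "f_count G arev r = card (closed_nb_walks G arev r)"

definition c_count :: "('v,'e) pre_digraph \<Rightarrow> ('e \<Rightarrow> 'e) \<Rightarrow> nat \<Rightarrow> nat" where
  "c_count G arev r = card {p \<in> closed_nb_walks G arev r. 1 \<le> r \<and> p ! 0 \<noteq> arev (p ! (r - 1))}"

definition couplings :: "real measure \<Rightarrow> real measure \<Rightarrow> (real \<times> real) measure set" where
  "couplings \<mu> \<nu> = {\<gamma>. prob_space \<gamma> \<and> sets \<gamma> = sets (borel \<Otimes>\<^sub>M borel) \<and>
      distr \<gamma> borel fst = \<mu> \<and> distr \<gamma> borel snd = \<nu>}"

definition wasserstein :: "real \<Rightarrow> real measure \<Rightarrow> real measure \<Rightarrow> ennreal" where
  "wasserstein p \<mu> \<nu> =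
    (let c = (INF \<gamma> \<in> couplings \<mu> \<nu>. \<integral>\<^sup>+ z. ennreal (\<bar>fst z - snd z\<bar> powr p) \<partial>\<gamma>)
     in if c = \<top> then \<top> else ennreal (enn2real c powr (1 / p)))"

definition quantile :: "real measure \<Rightarrow> real \<Rightarrow> real" where
  "quantile \<mu> x = Inf {y. x \<le> measure \<mu> {..y}}"

definition Lp01_dist :: "real \<Rightarrow> (real \<Rightarrow> real) \<Rightarrow> (real \<Rightarrow> real) \<Rightarrow> ennreal" where
  "Lp01_dist p f g =
    (let c = (\<integral>\<^sup>+ x \<in> {0..1}. ennreal (\<bar>f x - g x\<bar> powr p) \<partial>lborel)
     in if c = \<top> then \<top> else ennreal (enn2real c powr (1 / p)))"

end

theory Submission
  imports Defs "Jordan_Normal_Form.Schur_Decomposition"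
begin

text \<open>Let \<open>A\<^sub>r\<close> be the matrix counting non-backtracking walks of length \<open>r\<close>. Prepending a step gives
  \<open>A A\<^sub>r = A\<^sub>r\<^sub>+\<^sub>1 + q A\<^sub>r\<^sub>-\<^sub>1\<close> for \<open>r \<ge> 2\<close> (with \<open>q + 1\<close> instead of \<open>q\<close> for \<open>r = 1\<close>), so that
  \<open>q\<close> to the power \<open>-r/2\<close> times \<open>A\<^sub>r\<close> is \<open>U\<^sub>r - U\<^sub>r\<^sub>-\<^sub>2 / q\<close> evaluated at \<open>A / \<surd>q\<close>, where the Chebyshev polynomials \<open>U\<^sub>r\<close>
  are the orthogonal polynomials of the semicircle law. Taking traces, the normalized counts \<open>f\<^sub>r\<close> are
  the integrals of \<open>U\<^sub>r - U\<^sub>r\<^sub>-\<^sub>2 / q\<close>, which links (iii) and (v); \<open>q \<rightarrow> \<infinity>\<close> follows from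
  \<open>f\<^sub>2 \<ge> 0\<close>. Removing the tail of a closed walk gives \<open>f\<^sub>r \<le> c\<^sub>r + (q + 1) f\<^sub>r\<^sub>-\<^sub>2\<close>, hence (iv) and (v) agree.

  On the measure side: the quantile coupling gives (ii) to (i); a polynomial increment is dominated by
  \<open>\<epsilon> + C \<bar>x - y\<bar>\<close> to the power \<open>p\<close> for \<open>y\<close> in the compact support of the limit, which gives (i) to (iii); and moment
  convergence to a compactly supported law implies weak convergence by Weierstrass approximation, hence
  pointwise convergence of the quantiles, which bounded moments upgrade to \<open>L\<^sup>p\<close>, giving (iii) to (ii).\<close>

section \<open>Traces of polynomials in a symmetric matrix\<close>

unbundle no vec_syntax

text \<open>The usual Hermitian form argument: for an eigenvector \<open>v\<close>, real entries and
  symmetry allow the matrix to be moved from one factor of the form v* A v to the other, so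
  \<open>z * S = cnj z * S\<close>, where \<open>S\<close> is the squared norm of \<open>v\<close>
  and hence nonzero.\<close>

lemma real_symmetric_eigenvalue_real:
  fixes A :: "real mat" and z :: complex
  assumes A: "A \<in> carrier_mat n n" and sym: "\<And>i j. i < n \<Longrightarrow> j < n \<Longrightarrow> A $$ (i,j) = A $$ (j,i)"
    and ev: "eigenvalue (map_mat complex_of_real A) z"
  shows "z \<in> \<real>"
proof -
  let ?C = "map_mat complex_of_real A"
  have C: "?C \<in> carrier_mat n n" using A by simp
  obtain v where v: "v \<in> carrier_vec n" "v \<noteq> 0\<^sub>v n" and Cv: "?C *\<^sub>v v = z \<cdot>\<^sub>v v"
    using ev C unfolding eigenvalue_def eigenvector_def by auto
  define S where "S = (\<Sum>i<n. v $ i * cnj (v $ i))"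
  have row: "(\<Sum>j<n. complex_of_real (A $$ (i,j)) * v $ j) = z * v $ i" if i: "i < n" for i
  proof -
    have "(?C *\<^sub>v v) $ i = (\<Sum>j<n. complex_of_real (A $$ (i,j)) * v $ j)"
      using i A v by (simp add: scalar_prod_def lessThan_atLeast0)
    then show ?thesis using Cv i v by simp
  qed
  have "z * S = (\<Sum>i<n. (\<Sum>j<n. complex_of_real (A $$ (i,j)) * v $ j) * cnj (v $ i))"
    unfolding S_def sum_distrib_left by (intro sum.cong) (auto simp: row)
  also have "\<dots> = (\<Sum>j<n. \<Sum>i<n. complex_of_real (A $$ (i,j)) * v $ j * cnj (v $ i))"
    unfolding sum_distrib_right by (rule sum.swap)
  also have "\<dots> = (\<Sum>j<n. v $ j * cnj (\<Sum>i<n. complex_of_real (A $$ (j,i)) * v $ i))"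
    by (intro sum.cong) (auto simp: sum_distrib_left sym intro!: sum.cong)
  also have "\<dots> = cnj z * S"
    unfolding S_def sum_distrib_left by (intro sum.cong) (auto simp: row)
  finally have eq: "z * S = cnj z * S" .
  have "S \<noteq> 0"
  proof
    assume "S = 0"
    have "S = complex_of_real (\<Sum>i<n. (cmod (v $ i))\<^sup>2)"
      unfolding S_def of_real_sum by (intro sum.cong) (auto simp: complex_norm_square[symmetric])
    with \<open>S = 0\<close> have "(\<Sum>i<n. (cmod (v $ i))\<^sup>2) = 0" by (metis of_real_eq_0_iff)
    then have "\<forall>i<n. v $ i = 0"
      by (subst (asm) sum_nonneg_eq_0_iff) auto
    with v show False by (auto intro!: eq_vecI)
  qed
  with eq have "cnj z = z" by simp
  then show ?thesis by (simp add: Reals_cnj_iff)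
qed

text \<open>The complex factorization has only real roots, so it descends along the injective
  embedding of real into complex polynomials. The list of linear factors is the input required by
  \<open>schur_decomposition\<close>.\<close>

lemma real_symmetric_char_poly_splits:
  fixes A :: "real mat"
  assumes A: "A \<in> carrier_mat n n" and sym: "\<And>i j. i < n \<Longrightarrow> j < n \<Longrightarrow> A $$ (i,j) = A $$ (j,i)"
  obtains es where "char_poly A = (\<Prod>e\<leftarrow>es. [:- e, 1:])" "length es = n"
proof -
  let ?C = "map_mat complex_of_real A"
  have C: "?C \<in> carrier_mat n n" using A by simp
  obtain as where as: "char_poly ?C = (\<Prod>a\<leftarrow>as. [:- a, 1:])" "length as = n"
    using char_poly_factorized[OF C] by blast
  have real: "a = complex_of_real (Re a)" if "a \<in> set as" for a
  proof -
    have "poly (char_poly ?C) a = 0"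
      unfolding as poly_prod_list using that by (auto simp: prod_list_zero_iff)
    then have "eigenvalue ?C a" using eigenvalue_root_char_poly[OF C] by simp
    then have "a \<in> \<real>" using real_symmetric_eigenvalue_real[OF A sym] by blast
    then show ?thesis by simp
  qed
  interpret pinj: map_poly_inj_comm_ring_hom complex_of_real ..
  have "map_poly complex_of_real (char_poly A) = char_poly ?C"
    by (rule comm_ring_hom.char_poly_hom[OF _ A, symmetric]) unfold_locales
  also have "\<dots> = (\<Prod>a\<leftarrow>as. map_poly complex_of_real [:- Re a, 1:])"
    unfolding as using real by (intro arg_cong[where f=prod_list] map_cong) auto
  also have "\<dots> = map_poly complex_of_real (\<Prod>a\<leftarrow>map Re as. [:- a, 1:])"
    by (simp add: pinj.hom_prod_list o_def)
  finally have "char_poly A = (\<Prod>a\<leftarrow>map Re as. [:- a, 1:])"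
    by (rule pinj.injectivity)
  then show ?thesis using that[of "map Re as"] as(2) by simp
qed

section \<open>Traces of the non-backtracking matrices in terms of eigenvalues\<close>

definition mat_trace :: "'a :: comm_ring_1 mat \<Rightarrow> 'a" where
  "mat_trace M = (\<Sum>i<dim_row M. M $$ (i,i))"

lemma mat_trace_comm:
  assumes "X \<in> carrier_mat n n" "Y \<in> carrier_mat n n"
  shows "mat_trace (X * Y) = mat_trace (Y * X)"
proof -
  have "mat_trace (X * Y) = (\<Sum>i<n. \<Sum>j<n. X $$ (i,j) * Y $$ (j,i))"
    using assms by (auto simp: mat_trace_def scalar_prod_def lessThan_atLeast0 intro!: sum.cong)
  also have "\<dots> = (\<Sum>j<n. \<Sum>i<n. Y $$ (j,i) * X $$ (i,j))"
    by (subst sum.swap) (simp add: mult.commute)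
  also have "\<dots> = mat_trace (Y * X)"
    using assms by (auto simp: mat_trace_def scalar_prod_def lessThan_atLeast0 intro!: sum.cong)
  finally show ?thesis .
qed

text \<open>For the adjacency matrix \<open>A\<close> of a \<open>(q+1)\<close>-regular graph, the entries of \<open>nb_mat q A r\<close>
  count the non-backtracking walks of length \<open>r\<close>; the first step of the recursion is exceptional
  because a walk of length \<open>0\<close> can be prolonged in \<open>q + 1\<close> instead of \<open>q\<close> ways.\<close>

fun nb_mat :: "real \<Rightarrow> real mat \<Rightarrow> nat \<Rightarrow> real mat" where
  "nb_mat q A 0 = 1\<^sub>m (dim_row A)"
| "nb_mat q A (Suc 0) = A"
| "nb_mat q A (Suc (Suc r)) =
     A * nb_mat q A (Suc r) + (- (if r = 0 then q + 1 else q)) \<cdot>\<^sub>m nb_mat q A r"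

text \<open>Scalar form of the recursion for \<open>nb_mat\<close>: the matrix
  \<open>nb_mat q A r\<close> is the polynomial \<open>nb_val q x r\<close> in \<open>x\<close>,
  evaluated at \<open>A\<close>.\<close>

fun nb_val :: "real \<Rightarrow> real \<Rightarrow> nat \<Rightarrow> real" where
  "nb_val q x 0 = 1"
| "nb_val q x (Suc 0) = x"
| "nb_val q x (Suc (Suc r)) = x * nb_val q x (Suc r) - (if r = 0 then q + 1 else q) * nb_val q x r"

lemma nb_mat_carrier [simp]: "A \<in> carrier_mat n n \<Longrightarrow> nb_mat q A r \<in> carrier_mat n n"
proof (induction q A r rule: nb_mat.induct)
  case (1 q A)
  then show ?case by auto
next
  case (2 q A)
  then show ?case by simp
next
  case (3 q A r)
  then show ?case
    unfolding nb_mat.simps by (intro add_carrier_mat smult_carrier_mat) blast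
qed

text \<open>Polynomials in a matrix commute with conjugation. In the recursion step the inner
  factors \<open>Q * P\<close> of the product cancel.\<close>

lemma nb_mat_similar:
  assumes "similar_mat_wit A B P Q" and n: "n = dim_row A"
  shows "nb_mat q A r = P * nb_mat q B r * Q"
  using assms
proof (induction q A r rule: nb_mat.induct)
  case (1 q A)
  note w = similar_mat_witD[OF 1(2,1)]
  have "dim_row A = n" "dim_row B = n" using w(4,5) by auto
  then show ?case using right_mult_one_mat[OF w(6)] w(1) by simp
next
  case (2 q A)
  then show ?case using similar_mat_witD(3)[OF 2(2,1)] unfolding nb_mat.simps by simp
next
  case (3 q A r)
  note w = similar_mat_witD[OF 3(4,3)]
  note IH = 3(1)[OF 3(3,4)] 3(2)[OF 3(3,4)]
  let ?c = "- (if r = 0 then q + 1 else q)"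
  let ?X = "nb_mat q B (Suc r)" and ?Y = "nb_mat q B r"
  have X: "?X \<in> carrier_mat n n" and Y: "?Y \<in> carrier_mat n n" using w(5) by auto
  note w' = w(5,6,7) and AB = w(3)
  have XQ: "?X * Q \<in> carrier_mat n n" and BX: "B * ?X \<in> carrier_mat n n"
    and PB: "P * B \<in> carrier_mat n n" and PX: "P * ?X \<in> carrier_mat n n"
    and cY: "?c \<cdot>\<^sub>m ?Y \<in> carrier_mat n n" and PY: "P * ?Y \<in> carrier_mat n n"
    and PBX: "P * (B * ?X) \<in> carrier_mat n n"
    using w' X Y by (auto intro!: mult_carrier_mat)
  have "A * (P * ?X * Q) = P * B * Q * (P * (?X * Q))"
    using AB assoc_mult_mat[OF w'(2) X w'(3)] by simp
  also have "\<dots> = P * B * (Q * (P * (?X * Q)))"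
    by (rule assoc_mult_mat[OF PB w'(3)]) (use w' XQ in \<open>auto intro: mult_carrier_mat\<close>)
  also have "Q * (P * (?X * Q)) = ?X * Q"
    using assoc_mult_mat[OF w'(3,2) XQ] left_mult_one_mat[OF XQ] w(2) by simp
  also have "P * B * (?X * Q) = P * (B * (?X * Q))"
    by (rule assoc_mult_mat[OF w'(2,1) XQ])
  also have "B * (?X * Q) = B * ?X * Q"
    by (rule assoc_mult_mat[OF w'(1) X w'(3), symmetric])
  also have "P * (B * ?X * Q) = P * (B * ?X) * Q"
    by (rule assoc_mult_mat[OF w'(2) BX w'(3), symmetric])
  finally have 1: "A * (P * ?X * Q) = P * (B * ?X) * Q" .
  have 2: "?c \<cdot>\<^sub>m (P * ?Y * Q) = P * (?c \<cdot>\<^sub>m ?Y) * Q"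
    by (simp only: mult_smult_distrib[OF w'(2) Y] mult_smult_assoc_mat[OF PY w'(3)])
  have 3: "P * (B * ?X) * Q + P * (?c \<cdot>\<^sub>m ?Y) * Q = P * (B * ?X + ?c \<cdot>\<^sub>m ?Y) * Q"
    using add_mult_distrib_mat[OF PBX mult_carrier_mat[OF w'(2) cY] w'(3)]
      mult_add_distrib_mat[OF w'(2) BX cY] by simp
  show ?case
    unfolding nb_mat.simps(3) IH 1 2 3 ..
qed

text \<open>In the sum over \<open>k\<close> for the entry \<open>(i,j)\<close>, the first factor
  vanishes for \<open>k < i\<close> and the second for \<open>k > j\<close>. Nothing survives below
  the diagonal, and only \<open>k = i\<close> survives on it.\<close>

lemma upper_triangular_mult:
  fixes X Y :: "'a :: comm_ring_1 mat"
  assumes X: "X \<in> carrier_mat n n" "upper_triangular X" and Y: "Y \<in> carrier_mat n n" "upper_triangular Y"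
  shows "upper_triangular (X * Y)" "i < n \<Longrightarrow> (X * Y) $$ (i,i) = X $$ (i,i) * Y $$ (i,i)"
proof -
  have entry: "(X * Y) $$ (i,j) = (\<Sum>k\<in>{0..<n}. X $$ (i,k) * Y $$ (k,j))" if "i < n" "j < n" for i j
    using that X(1) Y(1) by (simp add: scalar_prod_def)
  show "upper_triangular (X * Y)"
  proof (rule upper_triangularI)
    fix i j assume ij: "j < i" "i < dim_row (X * Y)"
    have "X $$ (i,k) * Y $$ (k,j) = 0" if "k < n" for k
    proof (cases "k < i")
      case True
      then show ?thesis using ij X(1) upper_triangularD[OF X(2), of k i] by simp
    next
      case False
      then show ?thesis using ij that Y(1) upper_triangularD[OF Y(2), of j k] by simp
    qed
    then show "(X * Y) $$ (i,j) = 0" using ij X(1) Y(1) by (subst entry) auto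
  qed
  show "(X * Y) $$ (i,i) = X $$ (i,i) * Y $$ (i,i)" if i: "i < n"
  proof -
    have "X $$ (i,k) * Y $$ (k,i) = (if k = i then X $$ (i,i) * Y $$ (i,i) else 0)" if "k < n" for k
    proof (cases k i rule: linorder_cases)
      case less
      then show ?thesis using i X(1) upper_triangularD[OF X(2), of k i] by simp
    next
      case greater
      then show ?thesis using that Y(1) upper_triangularD[OF Y(2), of i k] by simp
    qed simp
    then have "(X * Y) $$ (i,i) = (\<Sum>k\<in>{0..<n}. if k = i then X $$ (i,i) * Y $$ (i,i) else 0)"
      unfolding entry[OF i i] by (intro sum.cong) simp_all
    then show ?thesis using i by simp
  qed
qed

text \<open>Diagonals of upper triangular matrices multiply entrywise, so along the diagonal the
  matrix recursion becomes the scalar one.\<close>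

lemma nb_mat_upper_triangular:
  assumes B: "B \<in> carrier_mat n n" "upper_triangular B"
  shows "upper_triangular (nb_mat q B r) \<and> (\<forall>i<n. nb_mat q B r $$ (i,i) = nb_val q (B $$ (i,i)) r)"
  using assms
proof (induction q B r rule: nb_mat.induct)
  case (3 q B r)
  have X: "nb_mat q B (Suc r) \<in> carrier_mat n n" "nb_mat q B r \<in> carrier_mat n n" using 3(3) by simp_all
  have IH: "upper_triangular (nb_mat q B (Suc r))" "upper_triangular (nb_mat q B r)"
    "\<And>i. i < n \<Longrightarrow> nb_mat q B (Suc r) $$ (i,i) = nb_val q (B $$ (i,i)) (Suc r)"
    "\<And>i. i < n \<Longrightarrow> nb_mat q B r $$ (i,i) = nb_val q (B $$ (i,i)) r"
    using 3(1,2)[OF 3(3,4)] by simp_all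
  note m = upper_triangular_mult[OF 3(3,4) X(1) IH(1)]
  have "upper_triangular (nb_mat q B (Suc (Suc r)))"
  proof (rule upper_triangularI)
    fix i j assume ij: "j < i" "i < dim_row (nb_mat q B (Suc (Suc r)))"
    with X have i: "i < n" by (simp del: mult_carrier_mat)
    have "(B * nb_mat q B (Suc r)) $$ (i,j) = 0" "nb_mat q B r $$ (i,j) = 0"
      using upper_triangularD[OF m(1) ij(1)] upper_triangularD[OF IH(2) ij(1)] i carrier_matD[OF X(2)] carrier_matD[OF X(1)] carrier_matD[OF 3(3)] by simp_all
    then show "nb_mat q B (Suc (Suc r)) $$ (i,j) = 0" using ij i carrier_matD[OF X(2)] by (simp del: index_mult_mat(1) nb_mat.simps(2) add: nb_mat.simps(3))
  qed
  moreover have "nb_mat q B (Suc (Suc r)) $$ (i,i) = nb_val q (B $$ (i,i)) (Suc (Suc r))" if "i < n" for i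
    using that carrier_matD[OF X(2)] m(2)[OF that] IH(3,4)[OF that] by (simp del: index_mult_mat(1) nb_mat.simps(2) nb_val.simps(2))
  ultimately show ?case by blast
next
  case (1 q B)
  then show ?case by (simp add: upper_triangular_def)
next
  case (2 q B)
  then show ?case by simp
qed

text \<open>Schur triangularization conjugates \<open>A\<close> to an upper triangular
  \<open>B\<close> with the eigenvalues on its diagonal. Conjugation preserves the trace by
  cyclicity, and the diagonal of \<open>nb_mat q B r\<close> is known.\<close>

lemma mat_trace_nb_mat:
  fixes A :: "real mat"
  assumes A: "A \<in> carrier_mat n n" and sym: "\<And>i j. i < n \<Longrightarrow> j < n \<Longrightarrow> A $$ (i,j) = A $$ (j,i)"
  shows "mat_trace (nb_mat q A r) = (\<Sum>x\<in>#proots (char_poly A). nb_val q x r)"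
    and "size (proots (char_poly A)) = n"
proof -
  obtain es where es: "char_poly A = (\<Prod>e\<leftarrow>es. [:- e, 1:])" "length es = n"
    using real_symmetric_char_poly_splits[OF A sym] by blast
  have roots: "proots (char_poly A) = mset es"
  proof -
    have "proots (\<Prod>e\<leftarrow>es. [:- e, 1:]) = mset es"
    proof (induction es)
      case (Cons e es)
      have "(\<Prod>e\<leftarrow>es. [:- e, 1:]) \<noteq> 0" by (auto simp: prod_list_zero_iff)
      then show ?case
        using Cons by (simp only: list.map prod_list.Cons, subst proots_mult) auto
    qed simp
    then show ?thesis using es by simp
  qed
  obtain B P Q where "schur_decomposition A es = (B,P,Q)" by (cases "schur_decomposition A es") auto
  from schur_decomposition[OF A es(1) this]
  have w: "similar_mat_wit A B P Q" and ut: "upper_triangular B" and dg: "diag_mat B = es" by auto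
  have n: "n = dim_row A" using A by simp
  note wD = similar_mat_witD[OF n w]
  have X: "nb_mat q B r \<in> carrier_mat n n" using wD(5) by simp
  have "mat_trace (nb_mat q A r) = mat_trace (P * (nb_mat q B r * Q))"
    unfolding nb_mat_similar[OF w n] by (simp only: assoc_mult_mat[OF wD(6) X wD(7)])
  also have "\<dots> = mat_trace (nb_mat q B r * Q * P)"
    by (rule mat_trace_comm[OF wD(6) mult_carrier_mat[OF X wD(7)]])
  also have "nb_mat q B r * Q * P = nb_mat q B r"
    using assoc_mult_mat[OF X wD(7,6)] wD(2) right_mult_one_mat[OF X] by simp
  also have "mat_trace (nb_mat q B r) = (\<Sum>i<n. nb_val q (B $$ (i,i)) r)"
    using nb_mat_upper_triangular[OF wD(5) ut] carrier_matD[OF X] by (simp add: mat_trace_def)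
  also have "\<dots> = (\<Sum>x\<leftarrow>es. nb_val q x r)"
    unfolding dg[symmetric] diag_mat_def carrier_matD(1)[OF wD(5)]
    by (simp add: sum_list_sum_nth lessThan_atLeast0)
  finally show "mat_trace (nb_mat q A r) = (\<Sum>x\<in>#proots (char_poly A). nb_val q x r)"
    unfolding roots by (simp only: sum_mset_sum_list[symmetric] mset_map)
  show "size (proots (char_poly A)) = n" using roots es by simp
qed

section \<open>Non-backtracking walks\<close>

locale fin_bidirected_digraph = fin_digraph G + bidirected_digraph G arev for G arev
begin

text \<open>Both endpoints are fixed, so that the cardinalities can serve as matrix entries;
  \<open>successively\<close> replaces the indices of \<open>closed_nb_walks\<close> because it
  unfolds well when an arc is prepended.\<close>

definition nb_walks :: "nat \<Rightarrow> 'a \<Rightarrow> 'a \<Rightarrow> 'b list set" where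
  "nb_walks r u v = {p. length p = r \<and> awalk u p v \<and> successively (\<lambda>e f. f \<noteq> arev e) p}"

lemma finite_nb_walks [simp]: "finite (nb_walks r u v)"
proof (rule finite_subset)
  show "nb_walks r u v \<subseteq> {p. set p \<subseteq> arcs G \<and> length p = r}"
    by (auto simp: nb_walks_def awalk_def)
qed (simp add: finite_lists_length_eq)

lemma nb_walks_0: "u \<in> verts G \<Longrightarrow> nb_walks 0 u v = (if u = v then {[]} else {})"
  by (auto simp: nb_walks_def awalk_def)

lemma nb_walks_1: "nb_walks (Suc 0) u v = (\<lambda>e. [e]) ` {e \<in> arcs G. tail G e = u \<and> head G e = v}"
proof (intro equalityI subsetI)
  fix p assume "p \<in> nb_walks (Suc 0) u v"
  then have p: "length p = Suc 0" "awalk u p v" by (auto simp: nb_walks_def)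
  then obtain e where "p = [e]" by (auto simp: length_Suc_conv)
  with p show "p \<in> (\<lambda>e. [e]) ` {e \<in> arcs G. tail G e = u \<and> head G e = v}"
    by (auto simp: awalk_def)
next
  fix p assume "p \<in> (\<lambda>e. [e]) ` {e \<in> arcs G. tail G e = u \<and> head G e = v}"
  then show "p \<in> nb_walks (Suc 0) u v" by (auto simp: nb_walks_def awalk_def)
qed

lemma Cons_in_nb_walks:
  "e # p \<in> nb_walks (Suc r) u v \<longleftrightarrow>
     e \<in> out_arcs G u \<and> p \<in> nb_walks r (head G e) v \<and> (p = [] \<or> hd p \<noteq> arev e)"
  by (cases p) (auto simp: nb_walks_def awalk_def)

lemma nb_walks_Suc_elim:
  assumes "p \<in> nb_walks (Suc r) u v"
  obtains e p' where "p = e # p'" "e \<in> out_arcs G u" "p' \<in> nb_walks r (head G e) v"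
    "p' = [] \<or> hd p' \<noteq> arev e"
proof (cases p)
  case Nil
  then show ?thesis using assms by (simp add: nb_walks_def)
next
  case (Cons e p')
  then show ?thesis using assms Cons_in_nb_walks that by blast
qed

text \<open>A step \<open>e\<close> prepended to a non-backtracking walk either gives a non-backtracking walk, or cancels
  against the first step and leaves a walk not starting with \<open>e\<close>.\<close>

lemma card_nb_walks_step:
  assumes deg: "card (out_arcs G u) = q + 1"
  shows "(\<Sum>e\<in>out_arcs G u. card (nb_walks (Suc r) (head G e) v)) =
    card (nb_walks (Suc (Suc r)) u v) + (if r = 0 then q + 1 else q) * card (nb_walks r u v)"
proof -
  let ?S = "Sigma (out_arcs G u) (\<lambda>e. nb_walks (Suc r) (head G e) v)"
  let ?good = "(\<lambda>p. (hd p, tl p)) ` nb_walks (Suc (Suc r)) u v"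
  \<comment> \<open>Since \<open>arev (arev e) = e\<close>, the list \<open>arev e # p\<close> is
    non-backtracking exactly when \<open>p\<close> does not begin with \<open>e\<close>.\<close>
  let ?T = "Sigma (nb_walks r u v) (\<lambda>p. {e \<in> out_arcs G u. p = [] \<or> hd p \<noteq> e})"
  let ?bad = "(\<lambda>(p, e). (e, arev e # p)) ` ?T"
  have "?S = ?good \<union> ?bad"
  proof (intro equalityI subsetI)
    fix x assume "x \<in> ?S"
    then obtain e p where x: "x = (e,p)" "e \<in> out_arcs G u" and p: "p \<in> nb_walks (Suc r) (head G e) v"
      by auto
    from p obtain f p' where p': "p = f # p'" "f \<in> out_arcs G (head G e)" "p' \<in> nb_walks r (head G f) v"
      "p' = [] \<or> hd p' \<noteq> arev f" by (rule nb_walks_Suc_elim)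
    show "x \<in> ?good \<union> ?bad"
    proof (cases "f = arev e")
      case True
      with x p' have "(p', e) \<in> ?T" by auto
      then have "x \<in> ?bad" using x p' True by force
      then show ?thesis ..
    next
      case False
      with x p p' have "e # p \<in> nb_walks (Suc (Suc r)) u v" by (subst Cons_in_nb_walks) auto
      then have "x \<in> ?good" using x by force
      then show ?thesis ..
    qed
  next
    fix x assume "x \<in> ?good \<union> ?bad"
    then show "x \<in> ?S"
    proof
      assume "x \<in> ?good"
      then obtain p where p: "p \<in> nb_walks (Suc (Suc r)) u v" "x = (hd p, tl p)" by auto
      from p(1) show ?thesis by (rule nb_walks_Suc_elim) (use p in auto)
    next
      assume "x \<in> ?bad"
      then obtain p e where "p \<in> nb_walks r u v" "e \<in> out_arcs G u" "p = [] \<or> hd p \<noteq> e" "x = (e, arev e # p)"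
        by auto
      then show ?thesis by (auto simp: Cons_in_nb_walks)
    qed
  qed
  moreover have "?good \<inter> ?bad = {}"
  proof (rule Int_emptyI)
    fix x assume "x \<in> ?good" and bad: "x \<in> ?bad"
    then obtain p where p: "p \<in> nb_walks (Suc (Suc r)) u v" and x: "x = (hd p, tl p)" by blast
    from p have "hd (tl p) \<noteq> arev (hd p)"
    proof (rule nb_walks_Suc_elim)
      fix e p' assume "p = e # p'" "p' \<in> nb_walks (Suc r) (head G e) v" "p' = [] \<or> hd p' \<noteq> arev e"
      then show ?thesis by (cases p') (simp_all add: nb_walks_def)
    qed
    moreover obtain y where "x = (\<lambda>(p, e). (e, arev e # p)) y" using bad by (elim imageE)
    then have "tl p = arev (hd p) # fst y" using x by (cases y) simp
    ultimately show False by simp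
  qed
  moreover have "inj_on (\<lambda>p. (hd p, tl p)) (nb_walks (Suc (Suc r)) u v)"
  proof (rule inj_onI)
    fix p p' assume "p \<in> nb_walks (Suc (Suc r)) u v" "p' \<in> nb_walks (Suc (Suc r)) u v"
    then have "p \<noteq> []" "p' \<noteq> []" by (auto simp: nb_walks_def)
    moreover assume "(hd p, tl p) = (hd p', tl p')"
    ultimately show "p = p'" by (simp add: list.expand)
  qed
  then have "card ?good = card (nb_walks (Suc (Suc r)) u v)"
    by (rule card_image)
  moreover have "card ?bad = card ?T"
    by (intro card_image inj_onI) auto
  moreover have "card ?T = (if r = 0 then q + 1 else q) * card (nb_walks r u v)"
  proof -
    \<comment> \<open>The empty walk forbids no arc, which gives \<open>q + 1\<close>; a nonempty
      one forbids exactly its first arc, which leaves \<open>q\<close>.\<close>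
    have "card {e \<in> out_arcs G u. p = [] \<or> hd p \<noteq> e} = (if r = 0 then q + 1 else q)"
      if p: "p \<in> nb_walks r u v" for p
    proof (cases r)
      case 0
      with p have "p = []" by (simp add: nb_walks_def)
      with 0 deg show ?thesis by (simp del: in_out_arcs_conv)
    next
      case (Suc r')
      with p have "p \<in> nb_walks (Suc r') u v" by simp
      then have "hd p \<in> out_arcs G u" "p \<noteq> []"
        by (auto elim: nb_walks_Suc_elim simp del: in_out_arcs_conv)
      moreover from this have "{e \<in> out_arcs G u. p = [] \<or> hd p \<noteq> e} = out_arcs G u - {hd p}" by auto
      ultimately show ?thesis using deg Suc by (simp del: in_out_arcs_conv)
    qed
    then show ?thesis by (subst card_SigmaI) auto
  qed
  moreover have "finite ?good" "finite ?bad" by auto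
  moreover have "card ?S = (\<Sum>e\<in>out_arcs G u. card (nb_walks (Suc r) (head G e) v))"
    by (subst card_SigmaI) auto
  ultimately show ?thesis
    using card_Un_disjoint[of ?good ?bad] by simp
qed

lemma closed_nb_walks_eq: "closed_nb_walks G arev r = (\<Union>u\<in>verts G. nb_walks r u u)"
  by (fastforce simp: closed_nb_walks_def nb_walks_def successively_conv_nth awalk_def)

lemma finite_closed_nb_walks [simp]: "finite (closed_nb_walks G arev r)"
  by (simp add: closed_nb_walks_eq)

text \<open>For positive length the first arc determines the starting vertex, so the union over
  vertices is disjoint. At length \<open>0\<close> the empty list would be shared by all
  vertices.\<close>

lemma f_count_eq:
  assumes "r \<ge> 1"
  shows "f_count G arev r = (\<Sum>u\<in>verts G. card (nb_walks r u u))"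
  unfolding f_count_def closed_nb_walks_eq
proof (rule card_UN_disjoint)
  have "tail G (hd p) = u" if "p \<in> nb_walks r u u" for p u
    using that assms by (cases r) (auto elim: nb_walks_Suc_elim)
  then show "\<forall>u\<in>verts G. \<forall>v\<in>verts G. u \<noteq> v \<longrightarrow> nb_walks r u u \<inter> nb_walks r v v = {}"
    by blast
qed auto

section \<open>Walk counts as entries of matrices and as sums over eigenvalues\<close>

lemma vert_enum_bij: "bij_betw (vert_enum G) {0..<card (verts G)} (verts G)"
  using someI_ex[OF ex_bij_betw_nat_finite[OF finite_verts]] unfolding vert_enum_def .

lemma adj_mat_carrier: "adj_mat G \<in> carrier_mat (card (verts G)) (card (verts G))"
  by (simp add: adj_mat_def)

text \<open>Inversion \<open>arev\<close> matches the arcs from \<open>a\<close> to \<open>b\<close>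
  with those from \<open>b\<close> to \<open>a\<close>.\<close>

lemma adj_mat_sym:
  assumes "i < card (verts G)" "j < card (verts G)"
  shows "adj_mat G $$ (i,j) = adj_mat G $$ (j,i)"
proof -
  have "adj_count G a b = adj_count G b a" for a b
    unfolding adj_count_def
    by (rule bij_betw_same_card[of arev]) (rule bij_betwI[where g = arev], auto)
  then show ?thesis using assms by (simp add: adj_mat_def)
qed

text \<open>Multiplying by the adjacency matrix sums over all first steps, and
  \<open>card_nb_walks_step\<close> says that this sum obeys the recursion that defines
  \<open>nb_mat\<close>.\<close>

lemma nb_mat_adj_mat:
  assumes reg: "regular_deg G (q + 1)" and "i < card (verts G)" "j < card (verts G)"
  shows "nb_mat (real q) (adj_mat G) r $$ (i,j) = real (card (nb_walks r (vert_enum G i) (vert_enum G j)))"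
  using assms(2,3)
proof (induction r arbitrary: i j rule: less_induct)
  case (less r)
  let ?n = "card (verts G)" and ?ve = "vert_enum G" and ?A = "adj_mat G" and ?q = "real q"
  have ve: "?ve i \<in> verts G" if "i < ?n" for i
    using vert_enum_bij that by (auto dest: bij_betwE)
  have inj: "?ve i = ?ve j \<longleftrightarrow> i = j"
    using vert_enum_bij less(2,3) by (auto simp: bij_betw_def inj_on_def)
  have adj: "?A $$ (i,k) = real (adj_count G (?ve i) (?ve k))" if "k < ?n" for k
    using less that by (simp add: adj_mat_def)
  consider "r = 0" | "r = Suc 0" | s where "r = Suc (Suc s)"
    by (metis not0_implies_Suc)
  then show ?case
  proof cases
    case 1
    then show ?thesis using less ve inj by (simp add: nb_walks_0 adj_mat_def)
  next
    case 2
    then show ?thesis using adj[OF less(3)]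
      by (simp add: nb_walks_1 card_image inj_on_def adj_count_def)
  next
    case (3 s)
    have X: "nb_mat ?q ?A (Suc s) \<in> carrier_mat ?n ?n" "nb_mat ?q ?A s \<in> carrier_mat ?n ?n"
      using adj_mat_carrier by simp_all
    have "(?A * nb_mat ?q ?A (Suc s)) $$ (i,j)
        = (\<Sum>k\<in>{0..<?n}. ?A $$ (i,k) * nb_mat ?q ?A (Suc s) $$ (k,j))"
      using less(2,3) carrier_matD[OF X(1)] carrier_matD[OF adj_mat_carrier]
      by (simp add: scalar_prod_def del: nb_mat.simps)
    also have "\<dots> = (\<Sum>k\<in>{0..<?n}. real (adj_count G (?ve i) (?ve k) *
                      card (nb_walks (Suc s) (?ve k) (?ve j))))"
      using less(1)[of "Suc s"] less(3) 3 adj by (intro sum.cong) simp_all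
    also have "\<dots> = (\<Sum>w\<in>verts G. real (adj_count G (?ve i) w * card (nb_walks (Suc s) w (?ve j))))"
      by (rule sum.reindex_bij_betw[OF vert_enum_bij])
    \<comment> \<open>The weight \<open>adj_count\<close> is resolved into single arcs, so that the
      sum over neighbours becomes a sum over outgoing arcs grouped by their heads.\<close>
    also have "\<dots> = (\<Sum>w\<in>verts G. \<Sum>e\<in>{e \<in> out_arcs G (?ve i). head G e = w}.
                      real (card (nb_walks (Suc s) (head G e) (?ve j))))"
      by (intro sum.cong) (auto simp: adj_count_def out_arcs_def conj_assoc)
    also have "\<dots> = (\<Sum>e\<in>out_arcs G (?ve i). real (card (nb_walks (Suc s) (head G e) (?ve j))))"
      by (rule sum.group) (auto simp: finite_out_arcs)
    also have "\<dots> = real (card (nb_walks (Suc (Suc s)) (?ve i) (?ve j)) +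
         (if s = 0 then q + 1 else q) * card (nb_walks s (?ve i) (?ve j)))"
    proof -
      have "card (out_arcs G (?ve i)) = q + 1"
        using reg ve[OF less(2)] by (auto simp: regular_deg_def out_arcs_def)
      from card_nb_walks_step[OF this, of s "?ve j"] show ?thesis
        by (simp flip: of_nat_sum)
    qed
    finally have "(?A * nb_mat ?q ?A (Suc s)) $$ (i,j) = \<dots>" .
    moreover have "nb_mat ?q ?A s $$ (i,j) = real (card (nb_walks s (?ve i) (?ve j)))"
      using less 3 by simp
    ultimately show ?thesis
      unfolding 3 nb_mat.simps
      using less(2,3) carrier_matD[OF X(2)]
      by (simp del: index_mult_mat(1) nb_mat.simps)
  qed
qed

text \<open>The trace of \<open>nb_mat\<close> is computed twice: from its diagonal entries, which
  count closed walks at each vertex, and from the spectrum.\<close>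

lemma f_count_eigenvalues:
  assumes reg: "regular_deg G (q + 1)" and r: "r \<ge> 1"
  shows "real (f_count G arev r) = (\<Sum>x\<in>#adj_eigs G. nb_val (real q) x r)"
proof -
  let ?n = "card (verts G)"
  have "(\<Sum>x\<in>#adj_eigs G. nb_val (real q) x r) = mat_trace (nb_mat (real q) (adj_mat G) r)"
    unfolding adj_eigs_def
    by (rule mat_trace_nb_mat(1)[OF adj_mat_carrier adj_mat_sym, symmetric])
  also have "\<dots> = (\<Sum>i\<in>{0..<?n}. real (card (nb_walks r (vert_enum G i) (vert_enum G i))))"
    using nb_mat_adj_mat[OF reg] carrier_matD[OF nb_mat_carrier[OF adj_mat_carrier]]
    by (simp add: mat_trace_def lessThan_atLeast0)
  also have "\<dots> = (\<Sum>u\<in>verts G. real (card (nb_walks r u u)))"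
    by (rule sum.reindex_bij_betw[OF vert_enum_bij])
  finally show ?thesis using f_count_eq[OF r] by simp
qed

lemma size_adj_eigs: "size (adj_eigs G) = card (verts G)"
  unfolding adj_eigs_def by (rule mat_trace_nb_mat(2)[OF adj_mat_carrier adj_mat_sym])

section \<open>Comparison of circuits with closed non-backtracking walks\<close>

lemma c_count_le_f_count: "c_count G arev r \<le> f_count G arev r"
  unfolding c_count_def f_count_def by (intro card_mono) auto

lemma closed_nb_walks_arcs: "p \<in> closed_nb_walks G arev r \<Longrightarrow> set p \<subseteq> arcs G"
  by (auto simp: closed_nb_walks_def awalk_def)

text \<open>A closed walk of one arc is a circuit because \<open>arev\<close> has no fixed point
  among the arcs.\<close>

lemma c_count_1: "c_count G arev 1 = f_count G arev 1"
proof -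
  have "p ! 0 \<noteq> arev (p ! 0)" if "p \<in> closed_nb_walks G arev 1" for p
  proof -
    have "length p = 1" "set p \<subseteq> arcs G"
      using that closed_nb_walks_arcs[OF that] by (auto simp: closed_nb_walks_def)
    then have "p ! 0 \<in> arcs G" by (cases p) auto
    then show ?thesis using arev_neq by metis
  qed
  then show ?thesis unfolding c_count_def f_count_def by (intro arg_cong[where f=card]) auto
qed

text \<open>At length 2 the closing condition is the non-backtracking condition at index 0, read
  through the involution \<open>arev\<close>.\<close>

lemma c_count_2: "c_count G arev 2 = f_count G arev 2"
proof -
  have "p ! 0 \<noteq> arev (p ! 1)" if "p \<in> closed_nb_walks G arev 2" for p
    using that unfolding closed_nb_walks_def by (auto dest!: spec[of _ 0])
  then show ?thesis unfolding c_count_def f_count_def by (intro arg_cong[where f=card]) auto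
qed

lemma card_in_arcs: "card (in_arcs G w) = card (out_arcs G w)"
  unfolding in_arcs_eq by (intro card_image inj_on_arev)

text \<open>A closed walk of length \<open>r + 2\<close> that is not a circuit has the form
  \<open>e # p @ [arev e]\<close>, where \<open>p\<close> is a closed non-backtracking walk of
  length \<open>r\<close> and \<open>e\<close> ends where \<open>p\<close> starts. Since
  \<open>r\<close> is positive, \<open>p\<close> is nonempty and its base point is
  \<open>tail G (hd p)\<close>; by regularity there are \<open>q + 1\<close> candidates for
  \<open>e\<close>.\<close>

lemma f_count_le_c_count:
  assumes reg: "regular_deg G (q + 1)" and r: "r \<ge> 1"
  shows "f_count G arev (r + 2) \<le> c_count G arev (r + 2) + (q + 1) * f_count G arev r"
proof -
  let ?F = "closed_nb_walks G arev" 
  let ?C = "{p \<in> ?F (r + 2). 1 \<le> r + 2 \<and> p ! 0 \<noteq> arev (p ! (r + 2 - 1))}"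
  let ?T = "Sigma (?F r) (\<lambda>p. in_arcs G (tail G (hd p)))"
  have "?F (r + 2) - ?C \<subseteq> (\<lambda>(p, e). e # p @ [arev e]) ` ?T"
  proof
    fix p assume p: "p \<in> ?F (r + 2) - ?C"
    then have len: "length p = r + 2" and rev: "p ! 0 = arev (p ! (r + 1))"
      by (auto simp: closed_nb_walks_def)
    from len obtain e p1 where p1: "p = e # p1" "length p1 = Suc r" by (auto simp: length_Suc_conv)
    obtain p2 f where p2: "p1 = p2 @ [f]" "length p2 = r"
      using p1 by (metis length_append_singleton length_Suc_conv_rev nat.inject)
    have f: "f = arev e" using rev p1 p2 by (simp add: nth_append)
    from p obtain u where u: "awalk u p u" and succ: "successively (\<lambda>e f. f \<noteq> arev e) p"
      by (auto simp: closed_nb_walks_def successively_conv_nth len)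
    have ne: "p2 \<noteq> []" using p2 r by auto
    have e: "e \<in> arcs G" and aw: "awalk (head G e) p2 (head G e)"
      using u unfolding p1 p2 f by (auto simp: awalk_simps)
    have "successively (\<lambda>e f. f \<noteq> arev e) p2"
      using succ unfolding p1 p2 by (auto simp: successively_append_iff successively_Cons)
    then have "p2 \<in> ?F r" using aw p2(2) by (auto simp: closed_nb_walks_def successively_conv_nth)
    moreover have "e \<in> in_arcs G (tail G (hd p2))"
      using e aw ne by (cases p2) (auto simp: awalk_simps)
    ultimately have "(p2, e) \<in> ?T" by (simp del: in_in_arcs_conv)
    then show "p \<in> (\<lambda>(p, e). e # p @ [arev e]) ` ?T"
      unfolding p1 p2 f by force
  qed
  then have "card (?F (r + 2) - ?C) \<le> card ?T"
    by (rule surj_card_le[rotated]) (auto intro!: finite_SigmaI)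
  also have "card ?T = (\<Sum>p\<in>?F r. card (in_arcs G (tail G (hd p))))"
    by (rule card_SigmaI) auto
  also have "\<dots> = (\<Sum>p\<in>?F r. q + 1)"
  proof (rule sum.cong)
    fix p assume "p \<in> ?F r"
    then have "set p \<subseteq> arcs G" "p \<noteq> []"
      using closed_nb_walks_arcs r by (auto simp: closed_nb_walks_def)
    then have "tail G (hd p) \<in> verts G" by (cases p) auto
    then show "card (in_arcs G (tail G (hd p))) = q + 1"
      using reg by (auto simp: card_in_arcs regular_deg_def out_arcs_def)
  qed simp
  finally have "card (?F (r + 2) - ?C) \<le> (q + 1) * f_count G arev r"
    by (simp only: f_count_def sum_constant mult.commute of_nat_id)
  moreover have "card (?F (r + 2)) = card ?C + card (?F (r + 2) - ?C)"
    by (subst card_Un_disjoint[symmetric]) (auto intro!: arg_cong[where f=card])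
  ultimately show ?thesis unfolding f_count_def c_count_def by simp
qed

end

section \<open>Chebyshev polynomials and the semicircle law\<close>

text \<open>Chebyshev polynomials of the second kind, rescaled to [-2, 2]: the value at 2 cos t is
  sin((r+1)t) / sin t where sin t is nonzero.\<close>

fun cheb_U :: "nat \<Rightarrow> real poly" where
  "cheb_U 0 = 1"
| "cheb_U (Suc 0) = [:0, 1:]"
| "cheb_U (Suc (Suc r)) = [:0, 1:] * cheb_U (Suc r) - cheb_U r"

text \<open>Once the exceptional coefficient \<open>q + 1\<close> has been used, both sides satisfy
  the same three-term recursion. The initial values at lengths 2 and 3 carry the effect of that
  coefficient, which is the correction by \<open>cheb_U r\<close> over
  \<open>s\<^sup>2\<close>.\<close>

lemma nb_val_eq_cheb_U:
  assumes "s > 0"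
  shows "nb_val (s\<^sup>2) (s * x) (Suc (Suc r)) =
    s ^ Suc (Suc r) * (poly (cheb_U (Suc (Suc r))) x - poly (cheb_U r) x / s\<^sup>2)"
proof (induction r rule: less_induct)
  case (less r)
  consider "r = 0" | "r = 1" | k where "r = Suc (Suc k)" by (metis not0_implies_Suc One_nat_def)
  then show ?case
  proof cases
    case 1
    then show ?thesis using assms by (simp add: field_simps power2_eq_square)
  next
    case 2
    then show ?thesis using assms by (simp add: field_simps power2_eq_square)
  next
    case (3 k)
    define u v where "u = poly (cheb_U (Suc (Suc k))) x" and "v = poly (cheb_U (Suc k)) x"
    define w where "w = poly (cheb_U k) x"
    have U: "poly (cheb_U (Suc (Suc (Suc k)))) x = x * u - v" "u = x * v - w"
      "poly (cheb_U (Suc (Suc (Suc (Suc k))))) x = x * (x * u - v) - u"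
      by (simp_all add: u_def v_def w_def)
    \<comment> \<open>Eliminating \<open>w\<close> reduces the recursion step to an algebraic
      identity in \<open>u\<close> and \<open>v\<close>.\<close>
    have w: "w = x * v - u" using U(2) by simp
    have 1: "nb_val (s\<^sup>2) (s * x) (Suc (Suc k)) = s ^ Suc (Suc k) * (u - w / s\<^sup>2)"
      and 2: "nb_val (s\<^sup>2) (s * x) (Suc (Suc (Suc k))) = s ^ Suc (Suc (Suc k)) * (x * u - v - v / s\<^sup>2)"
      using less[of k] less[of "Suc k"] unfolding 3 U(1) u_def[symmetric] v_def[symmetric] w_def[symmetric]
      by simp_all
    have "nb_val (s\<^sup>2) (s * x) (Suc (Suc r)) =
        s * x * nb_val (s\<^sup>2) (s * x) (Suc (Suc (Suc k))) - s\<^sup>2 * nb_val (s\<^sup>2) (s * x) (Suc (Suc k))"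
      unfolding 3 by (subst nb_val.simps(3)) simp
    also have "\<dots> = s ^ 4 * s ^ k * (x * (x * u - v) - u - u / s\<^sup>2)"
      unfolding 1 2 w using assms by (simp add: field_simps power2_eq_square power4_eq_xxxx)
    finally show ?thesis
      unfolding 3 U(3) u_def[symmetric] by (simp add: power4_eq_xxxx mult.assoc)
  qed
qed

lemma poly_cheb_U_cos: "poly (cheb_U r) (2 * cos t) * sin t = sin (real (Suc r) * t)"
proof (induction r rule: cheb_U.induct)
  case 2
  then show ?case by (simp add: sin_double)
next
  case (3 r)
  have "poly (cheb_U (Suc (Suc r))) (2 * cos t) * sin t
      = 2 * cos t * (poly (cheb_U (Suc r)) (2 * cos t) * sin t) - poly (cheb_U r) (2 * cos t) * sin t"
    by (simp add: algebra_simps)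
  also have "\<dots> = 2 * cos t * sin (real (Suc (Suc r)) * t) - sin (real (Suc r) * t)"
    by (simp only: 3)
  also have "\<dots> = sin (real (Suc (Suc r)) * t + t)"
    using sin_add[of "real (Suc (Suc r)) * t" t] sin_diff[of "real (Suc (Suc r)) * t" t]
    by (simp add: algebra_simps)
  finally show ?case by (simp add: algebra_simps)
qed simp

text \<open>With x = 2 cos t the integrand becomes (2/pi) sin t sin((r+1)t), so this is the
  orthogonality of sines on [0, pi]. Instead of a change of variables, an explicit antiderivative in
  t is composed with arccos(x/2).\<close>

lemma has_integral_cheb_U_sqrt:
  "((\<lambda>x. sqrt (4 - x\<^sup>2) / (2 * pi) * poly (cheb_U r) x) has_integral (if r = 0 then 1 else 0)) {-2..2}"
proof -
  \<comment> \<open>Antiderivative of cos(kt) vanishing at 0; \<open>k = 0\<close> is separate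
    because the general formula would divide by zero.\<close>
  define h where "h k t = (if k = 0 then t else sin (real k * t) / real k)" for k :: nat and t :: real
  have h': "(h k has_real_derivative cos (real k * t)) (at t)" for k t
  proof (cases "k = 0")
    case True
    then have "h k = (\<lambda>t. t)" by (auto simp: h_def)
    then show ?thesis using True by simp
  next
    case False
    then have "h k = (\<lambda>t. sin (real k * t) / real k)" by (auto simp: h_def)
    then show ?thesis using False by (auto intro!: derivative_eq_intros)
  qed
  \<comment> \<open>From 2 sin t sin((r+1)t) = cos(rt) - cos((r+2)t); the minus sign comes from dx =
    -2 sin t dt.\<close>
  define g where "g t = - (h r t - h (r + 2) t) / pi" for t
  have g': "(g has_real_derivative - (2 * sin t * sin (real (Suc r) * t) / pi)) (at t)" for t
  proof -
    have "(g has_real_derivative - (cos (real r * t) - cos (real (r + 2) * t)) / pi) (at t)"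
      unfolding g_def by (auto intro!: derivative_eq_intros h')
    moreover have "cos (real r * t) - cos (real (r + 2) * t) = 2 * sin t * sin (real (Suc r) * t)"
      using cos_add[of "real (Suc r) * t" t] cos_diff[of "real (Suc r) * t" t]
      by (simp add: algebra_simps)
    ultimately show ?thesis by (simp only: minus_divide_left)
  qed
  have "((\<lambda>x. sqrt (4 - x\<^sup>2) / (2 * pi) * poly (cheb_U r) x) has_integral
      (g (arccos (2 / 2)) - g (arccos (-2 / 2)))) {-2..2}"
  \<comment> \<open>The derivative of arccos blows up at the endpoints, so differentiability is
    checked in the interior and only continuity on the closed interval.\<close>
  proof (rule fundamental_theorem_of_calculus_interior)
    have "continuous_on UNIV g"
      by (rule DERIV_continuous_on) (rule g')
    then show "continuous_on {-2..2} (\<lambda>x. g (arccos (x / 2)))"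
      by (rule continuous_on_compose2) (auto intro!: continuous_intros)
  next
    fix x :: real assume x: "x \<in> {-2<..<2}"
    define t where "t = arccos (x / 2)"
    have ct: "2 * cos t = x" using x by (simp add: t_def cos_arccos)
    have st: "sin t = sqrt (1 - (x / 2)\<^sup>2)" using x by (simp add: t_def sin_arccos)
    have "\<bar>x / 2\<bar> < 1" using x by (simp add: abs_less_iff)
    then have "1 - (x / 2)\<^sup>2 > 0" by (simp only: abs_square_less_1 diff_gt_0_iff_gt)
    then have st0: "sin t > 0" using st by simp
    have s4: "sqrt (4 - x\<^sup>2) = 2 * sin t"
    proof -
      have "sqrt (4 - x\<^sup>2) = sqrt (4 * (1 - (x / 2)\<^sup>2))" by (simp add: power_divide)
      also have "\<dots> = 2 * sin t" unfolding st real_sqrt_mult by simp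
      finally show ?thesis .
    qed
    have "((\<lambda>x. g (arccos (x / 2))) has_real_derivative
        - (2 * sin t * sin (real (Suc r) * t) / pi) * (inverse (- sqrt (1 - (x / 2)\<^sup>2)) * (1 / 2))) (at x)"
      unfolding t_def
      by (rule DERIV_chain2[OF g'], rule DERIV_chain2[OF DERIV_arccos])
        (use x in \<open>auto intro!: derivative_eq_intros\<close>)
    moreover have "- (2 * sin t * sin (real (Suc r) * t) / pi) * (inverse (- sqrt (1 - (x / 2)\<^sup>2)) * (1 / 2))
        = sqrt (4 - x\<^sup>2) / (2 * pi) * poly (cheb_U r) x"
    proof -
      have "sin (real (Suc r) * t) = poly (cheb_U r) x * sin t" using poly_cheb_U_cos[of r t] ct by simp
      then show ?thesis unfolding st[symmetric] s4 using st0 by (simp add: field_simps)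
    qed
    ultimately show "((\<lambda>x. g (arccos (x / 2))) has_vector_derivative
        sqrt (4 - x\<^sup>2) / (2 * pi) * poly (cheb_U r) x) (at x)"
      by (simp add: has_real_derivative_iff_has_vector_derivative)
  qed simp
  \<comment> \<open>The endpoints correspond to t = 0 and t = pi, where all sine terms vanish; only
    the linear term \<open>h 0\<close> contributes, and it occurs just for
    \<open>r = 0\<close>.\<close>
  moreover have "g (arccos (2 / 2)) - g (arccos (-2 / 2)) = (if r = 0 then 1 else 0)"
    using sin_npi[of "r + 2"] sin_npi[of r] by (simp add: g_def h_def field_simps)
  ultimately show ?thesis by simp
qed

section \<open>The semicircle law as a probability distribution\<close>

definition semicircle_density :: "real \<Rightarrow> real" where
  "semicircle_density x = indicator {-2..2} x * sqrt (4 - x\<^sup>2) / (2 * pi)"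

lemma semicircle_density_measurable [measurable]: "semicircle_density \<in> borel_measurable borel"
  unfolding semicircle_density_def by measurable

text \<open>The real \<open>sqrt\<close> of a negative number is negative, so outside [-2, 2] it is
  the indicator that prevents a negative value.\<close>

lemma semicircle_density_nonneg: "semicircle_density x \<ge> 0"
  using abs_le_square_iff[of x 2]
  by (auto simp: semicircle_density_def split: split_indicator intro!: divide_nonneg_nonneg)

lemma semicircle_eq: "semicircle = density lborel (\<lambda>x. ennreal (semicircle_density x))"
  by (simp add: semicircle_def semicircle_density_def)

lemma borel_measurable_poly [measurable]: "poly (P :: real poly) \<in> borel_measurable borel"
  by (intro borel_measurable_continuous_onI continuous_intros)

lemma sets_semicircle [simp, measurable_cong]: "sets semicircle = sets borel"
  by (simp add: semicircle_def)

lemma semicircle_poly: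
  "integrable lborel (\<lambda>x. semicircle_density x * poly P x)"
  "(\<integral>x. semicircle_density x * poly P x \<partial>lborel) =
     integral {-2..2} (\<lambda>x. sqrt (4 - x\<^sup>2) / (2 * pi) * poly P x)"
proof -
  have eq: "(\<lambda>x. semicircle_density x * poly P x) =
      (\<lambda>x. indicator {-2..2} x *\<^sub>R (sqrt (4 - x\<^sup>2) / (2 * pi) * poly P x))"
    by (auto simp: semicircle_density_def)
  have int: "integrable lborel (\<lambda>x. indicator {-2..2} x *\<^sub>R (sqrt (4 - x\<^sup>2) / (2 * pi) * poly P x))"
    by (rule borel_integrable_compact) (auto intro!: continuous_intros)
  then show "integrable lborel (\<lambda>x. semicircle_density x * poly P x)" by (simp only: eq)
  show "(\<integral>x. semicircle_density x * poly P x \<partial>lborel) =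
     integral {-2..2} (\<lambda>x. sqrt (4 - x\<^sup>2) / (2 * pi) * poly P x)"
    using set_borel_integral_eq_integral(2)[of "{-2..2}" "\<lambda>x. sqrt (4 - x\<^sup>2) / (2 * pi) * poly P x"] int
    unfolding eq set_integrable_def set_lebesgue_integral_def by blast
qed

lemma integral_semicircle_cheb_U: "(\<integral>x. poly (cheb_U r) x \<partial>semicircle) = (if r = 0 then 1 else 0)"
proof -
  have "(\<integral>x. poly (cheb_U r) x \<partial>semicircle) = (\<integral>x. semicircle_density x * poly (cheb_U r) x \<partial>lborel)"
    unfolding semicircle_eq
    by (subst integral_density) (auto simp: semicircle_density_nonneg)
  then show ?thesis using has_integral_cheb_U_sqrt[of r]
    by (simp add: semicircle_poly has_integral_iff)
qed

text \<open>The total mass is the integral of \<open>cheb_U 0\<close>, which has just been computed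
  to be 1.\<close>

lemma real_distribution_semicircle: "real_distribution semicircle"
proof -
  have "emeasure semicircle UNIV = (\<integral>\<^sup>+x. ennreal (semicircle_density x) \<partial>lborel)"
    unfolding semicircle_eq by (subst emeasure_density) auto
  also have "\<dots> = ennreal (\<integral>x. semicircle_density x \<partial>lborel)"
    using semicircle_poly(1)[of 1] by (intro nn_integral_eq_integral) (auto simp: semicircle_density_nonneg)
  also have "(\<integral>x. semicircle_density x \<partial>lborel) = 1"
  proof -
    have "(\<integral>x. semicircle_density x * poly (cheb_U 0) x \<partial>lborel) = 1"
      unfolding semicircle_poly(2) integral_unique[OF has_integral_cheb_U_sqrt] by simp
    then show ?thesis by simp
  qed
  finally have "prob_space semicircle"
    by (intro prob_spaceI) (simp add: semicircle_def)
  then show ?thesis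
    by (intro real_distribution.intro real_distribution_axioms.intro) simp_all
qed

lemma AE_semicircle: "AE x in semicircle. \<bar>x\<bar> \<le> 2"
  unfolding semicircle_eq
  by (subst AE_density) (auto simp: semicircle_density_def split: split_indicator)

lemma measure_semicircle_singleton: "measure semicircle {x} = 0"
proof -
  have "AE y in lborel. y \<in> {x} \<longrightarrow> ennreal (semicircle_density y) = 0"
    using AE_lborel_singleton[of x] by eventually_elim auto
  then have "{x} \<in> null_sets semicircle"
    unfolding semicircle_eq by (subst null_sets_density_iff) auto
  then show ?thesis by (simp add: null_sets_def measure_def)
qed

text \<open>A null interval would force the density to vanish almost everywhere on it, but the
  density is positive on (-2, 2). This makes the distribution function strictly increasing on the
  support.\<close>

lemma measure_semicircle_interval_pos:
  assumes "-2 \<le> a" "a < b" "b \<le> 2"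
  shows "measure semicircle {a<..b} > 0"
proof (rule ccontr)
  interpret real_distribution semicircle by (rule real_distribution_semicircle)
  assume "\<not> measure semicircle {a<..b} > 0"
  then have "{a<..b} \<in> null_sets semicircle"
    using measure_nonneg[of semicircle "{a<..b}"] by (auto simp: null_sets_def emeasure_eq_measure)
  then have "AE x in lborel. x \<in> {a<..b} \<longrightarrow> ennreal (semicircle_density x) = 0"
    unfolding semicircle_eq by (subst (asm) null_sets_density_iff) auto
  then have "AE x in lborel. x \<notin> {a<..<b}"
  proof eventually_elim
    case (elim x)
    show ?case
    proof
      assume x: "x \<in> {a<..<b}"
      then have "x\<^sup>2 < 4" using assms abs_square_less_1[of "x / 2"] by (auto simp: power_divide)
      then have "semicircle_density x > 0" using x assms by (simp add: semicircle_density_def)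
      then show False using elim x by simp
    qed
  qed
  then have "{a<..<b} \<in> null_sets lborel"
    by (subst AE_iff_null_sets) auto
  then show False using assms by (simp add: null_sets_def)
qed

section \<open>Couplings and quantiles\<close>

lemma tendsto_0_ennreal_iff:
  fixes f :: "'a \<Rightarrow> ennreal"
  shows "(f \<longlongrightarrow> 0) F \<longleftrightarrow> (\<forall>e>0. \<forall>\<^sub>F n in F. f n < ennreal e)"
proof
  assume "(f \<longlongrightarrow> 0) F"
  then show "\<forall>e>0. \<forall>\<^sub>F n in F. f n < ennreal e"
    by (auto intro!: order_tendstoD(2))
next
  assume *: "\<forall>e>0. \<forall>\<^sub>F n in F. f n < ennreal e"
  show "(f \<longlongrightarrow> 0) F"
  proof (rule order_tendstoI)
    fix a :: ennreal assume "0 < a"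
    obtain e where e: "0 < e" "ennreal e < a"
    proof (cases a)
      case (real r)
      then show ?thesis using \<open>0 < a\<close> that[of "r / 2"] by (simp add: ennreal_less_iff)
    next
      case top
      then show ?thesis using that[of 1] by simp
    qed
    then have "\<forall>\<^sub>F n in F. f n < ennreal e" using * by simp
    then show "\<forall>\<^sub>F n in F. f n < a" using e by (auto elim!: eventually_mono)
  qed auto
qed

text \<open>Both \<open>wasserstein\<close> and \<open>Lp01_dist\<close> are p-th roots of a cost,
  with infinite cost treated separately; this reduces their convergence to that of the cost.\<close>

lemma tendsto_0_ennreal_root_iff:
  fixes c :: "'a \<Rightarrow> ennreal" and p :: real
  assumes p: "p > 0"
  shows "((\<lambda>n. if c n = \<top> then \<top> else ennreal (enn2real (c n) powr (1 / p))) \<longlongrightarrow> 0) F \<longleftrightarrow> (c \<longlongrightarrow> 0) F"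
    (is "(?f \<longlongrightarrow> 0) F \<longleftrightarrow> _")
proof -
  have iff: "?f n < ennreal e \<longleftrightarrow> c n < ennreal (e powr p)" if e: "e > 0" for n e
  proof (cases "c n")
    case (real r)
    have "r powr (1 / p) < e \<longleftrightarrow> r < e powr p"
    proof -
      have "r powr (1 / p) < e \<longleftrightarrow> (r powr (1 / p)) powr p < e powr p"
        using p e powr_less_mono2[of p "r powr (1 / p)" e] powr_mono2[of p e "r powr (1 / p)"]
        by (auto simp: not_le[symmetric])
      then show ?thesis using real p by (simp add: powr_powr)
    qed
    then show ?thesis using real e by (simp add: ennreal_less_iff)
  qed simp
  have "(\<forall>e>0. \<forall>\<^sub>F n in F. ?f n < ennreal e) \<longleftrightarrow> (\<forall>e>0. \<forall>\<^sub>F n in F. c n < ennreal e)"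
  proof (intro iffI allI impI)
    fix e :: real assume *: "\<forall>e>0. \<forall>\<^sub>F n in F. ?f n < ennreal e" and e: "e > 0"
    then have "\<forall>\<^sub>F n in F. ?f n < ennreal (e powr (1 / p))" by simp
    then show "\<forall>\<^sub>F n in F. c n < ennreal e"
      using iff[of "e powr (1 / p)"] e p by (simp add: powr_powr)
  next
    fix e :: real assume *: "\<forall>e>0. \<forall>\<^sub>F n in F. c n < ennreal e" and e: "e > 0"
    then show "\<forall>\<^sub>F n in F. ?f n < ennreal e" by (simp only: iff[OF e]) simp
  qed
  then show ?thesis unfolding tendsto_0_ennreal_iff .
qed

lemma poly_abs_le:
  fixes P :: "real poly"
  assumes "1 \<le> S" "\<bar>x\<bar> \<le> S"
  shows "\<bar>poly P x\<bar> \<le> (\<Sum>i\<le>degree P. \<bar>coeff P i\<bar>) * S ^ degree P"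
proof -
  have "\<bar>poly P x\<bar> \<le> (\<Sum>i\<le>degree P. \<bar>coeff P i * x ^ i\<bar>)"
    unfolding poly_altdef by (rule sum_abs)
  also have "\<dots> \<le> (\<Sum>i\<le>degree P. \<bar>coeff P i\<bar> * S ^ degree P)"
  proof (rule sum_mono)
    fix i assume i: "i \<in> {..degree P}"
    have "\<bar>x\<bar> ^ i \<le> S ^ i" using assms by (intro power_mono) auto
    also have "S ^ i \<le> S ^ degree P" using i assms by (intro power_increasing) auto
    finally show "\<bar>coeff P i * x ^ i\<bar> \<le> \<bar>coeff P i\<bar> * S ^ degree P"
      by (simp add: abs_mult power_abs mult_left_mono)
  qed
  finally show ?thesis by (simp add: sum_distrib_right)
qed

text \<open>Close to the diagonal uniform continuity gives \<open>\<epsilon>\<close>. Away from it,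
  \<open>\<bar>x - y\<bar>\<close> is bounded below and \<open>y\<close> is bounded, so the
  polynomial growth of degree at most \<open>p\<close> is absorbed by the power of the
  distance.\<close>

lemma poly_diff_le:
  fixes P :: "real poly" and R p \<epsilon> :: real
  assumes R: "R \<ge> 0" and p: "real (degree P) \<le> p" and \<epsilon>: "\<epsilon> > 0"
  obtains C where "C \<ge> 0" "\<And>x y. \<bar>y\<bar> \<le> R \<Longrightarrow> \<bar>poly P x - poly P y\<bar> \<le> \<epsilon> + C * \<bar>x - y\<bar> powr p"
proof -
  have "uniformly_continuous_on {-(R+1)..R+1} (poly P)"
    by (intro compact_uniformly_continuous continuous_intros) auto
  then obtain d0 where d0: "d0 > 0" "\<And>x y. x \<in> {-(R+1)..R+1} \<Longrightarrow> y \<in> {-(R+1)..R+1} \<Longrightarrow>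
      dist x y < d0 \<Longrightarrow> dist (poly P x) (poly P y) < \<epsilon>"
    using \<epsilon> unfolding uniformly_continuous_on_def by metis
  \<comment> \<open>The bound \<open>d \<le> 1\<close> keeps \<open>x\<close> within the interval of
    radius \<open>R + 1\<close> on which uniform continuity was obtained.\<close>
  define d where "d = min d0 1"
  have d: "d > 0" "d \<le> 1" "d \<le> d0" using d0 by (auto simp: d_def)
  define K where "K = (\<Sum>i\<le>degree P. \<bar>coeff P i\<bar>)"
  define C where "C = 2 * K * (R + 1) ^ degree P * d powr (- p)"
  have K: "K \<ge> 0" by (auto simp: K_def intro: sum_nonneg)
  show ?thesis
  proof (rule that)
    show C: "C \<ge> 0" using K R by (simp add: C_def)
    fix x y :: real assume y: "\<bar>y\<bar> \<le> R"
    show "\<bar>poly P x - poly P y\<bar> \<le> \<epsilon> + C * \<bar>x - y\<bar> powr p"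
    proof (cases "\<bar>x - y\<bar> < d")
      case True
      then have "dist (poly P x) (poly P y) < \<epsilon>"
        using y d by (intro d0) (auto simp: dist_real_def)
      then show ?thesis using C by (simp add: dist_real_def add_increasing2)
    next
      case False
      define e where "e = \<bar>x - y\<bar> / d"
      have e: "e \<ge> 1" using False d by (simp add: e_def)
      \<comment> \<open>A common bound for 1, \<open>\<bar>x\<bar>\<close> and
        \<open>\<bar>y\<bar>\<close> that is proportional to \<open>e\<close>, so that its powers
        are powers of the distance.\<close>
      define S where "S = (R + 1) * e"
      have Re: "R + e \<le> S"
      proof -
        have "R \<le> R * e" using R e by (simp add: mult_le_cancel_left1)
        then show ?thesis by (simp add: S_def algebra_simps)
      qed
      have xy: "\<bar>x - y\<bar> \<le> e"
        unfolding e_def using d by (simp add: le_divide_eq mult_left_le)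
      have S: "1 \<le> S" "\<bar>x\<bar> \<le> S" "\<bar>y\<bar> \<le> S" using Re xy y e R by linarith+
      have "\<bar>poly P x - poly P y\<bar> \<le> \<bar>poly P x\<bar> + \<bar>poly P y\<bar>" by simp
      also have "\<dots> \<le> 2 * (K * S ^ degree P)"
        using poly_abs_le[OF S(1,2), of P] poly_abs_le[OF S(1,3), of P] by (simp add: K_def)
      also have "\<dots> = 2 * K * (R + 1) ^ degree P * e powr (degree P)"
        using e by (simp add: S_def power_mult_distrib powr_realpow)
      also have "\<dots> \<le> 2 * K * (R + 1) ^ degree P * e powr p"
        using e p K R by (intro mult_left_mono powr_mono) auto
      also have "e powr p = \<bar>x - y\<bar> powr p * d powr (- p)"
        using d by (simp add: e_def powr_divide powr_minus field_simps)
      finally show ?thesis using \<epsilon> by (simp add: C_def mult_ac)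
    qed
  qed
qed

lemma (in real_distribution) integrable_poly_bounded:
  fixes P :: "real poly"
  assumes "AE x in M. \<bar>x\<bar> \<le> R"
  shows "integrable M (poly P)"
proof (rule integrable_const_bound)
  show "AE x in M. norm (poly P x) \<le> (\<Sum>i\<le>degree P. \<bar>coeff P i\<bar>) * (max 1 R) ^ degree P"
    using assms by eventually_elim (auto intro!: poly_abs_le)
  have "poly P \<in> borel_measurable borel"
    by (intro borel_measurable_continuous_onI continuous_intros)
  then show "poly P \<in> borel_measurable M" by simp
qed

text \<open>Written over the coupling, the difference of the two integrals is the integral of an
  increment of \<open>P\<close>, which \<open>C\<close> controls by the transport cost.\<close>

lemma coupling_poly_diff:
  fixes P :: "real poly"
  assumes \<gamma>: "\<gamma> \<in> couplings M N"
    and intM: "integrable M (poly P)" and intN: "integrable N (poly P)"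
    and bd: "AE x in N. \<bar>x\<bar> \<le> R"
    and C: "C \<ge> 0" "\<And>x y. \<bar>y\<bar> \<le> R \<Longrightarrow> \<bar>poly P x - poly P y\<bar> \<le> \<epsilon> + C * \<bar>x - y\<bar> powr p"
    and \<epsilon>: "\<epsilon> \<ge> 0" and cost: "(\<integral>\<^sup>+ z. ennreal (\<bar>fst z - snd z\<bar> powr p) \<partial>\<gamma>) \<le> ennreal \<eta>" "\<eta> \<ge> 0"
  shows "\<bar>(\<integral>x. poly P x \<partial>M) - (\<integral>x. poly P x \<partial>N)\<bar> \<le> \<epsilon> + C * \<eta>"
proof -
  from \<gamma> interpret prob_space \<gamma> by (simp add: couplings_def)
  have sets [measurable_cong]: "sets \<gamma> = sets (borel \<Otimes>\<^sub>M borel)"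
    and M: "M = distr \<gamma> borel fst" and N: "N = distr \<gamma> borel snd"
    using \<gamma> by (auto simp: couplings_def)
  have meas [measurable]: "poly P \<in> borel_measurable borel"
    by (intro borel_measurable_continuous_onI continuous_intros)
  have fst [measurable]: "fst \<in> measurable \<gamma> borel" and snd [measurable]: "snd \<in> measurable \<gamma> borel"
    by measurable
  have ifst: "integrable \<gamma> (\<lambda>z. poly P (fst z))" and isnd: "integrable \<gamma> (\<lambda>z. poly P (snd z))"
    using intM intN unfolding M N by (simp_all add: integrable_distr_eq)
  have bd': "AE z in \<gamma>. \<bar>snd z\<bar> \<le> R"
    using bd unfolding N by (subst (asm) AE_distr_iff) auto
  have icost: "integrable \<gamma> (\<lambda>z. \<bar>fst z - snd z\<bar> powr p)"
    using cost(1) by (intro integrableI_bounded) (auto simp: le_less_trans)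
  have "(\<integral>x. poly P x \<partial>M) - (\<integral>x. poly P x \<partial>N) = (\<integral>z. poly P (fst z) - poly P (snd z) \<partial>\<gamma>)"
    using ifst isnd unfolding M N by (simp add: integral_distr)
  also have "\<bar>\<dots>\<bar> \<le> (\<integral>z. \<bar>poly P (fst z) - poly P (snd z)\<bar> \<partial>\<gamma>)"
    by (rule integral_abs_bound)
  also have "\<dots> \<le> (\<integral>z. \<epsilon> + C * \<bar>fst z - snd z\<bar> powr p \<partial>\<gamma>)"
    using bd' C(2) by (intro integral_mono_AE) (auto intro!: ifst isnd icost)
  also have "\<dots> = \<epsilon> + C * (\<integral>z. \<bar>fst z - snd z\<bar> powr p \<partial>\<gamma>)"
    using icost by (simp add: prob_space)
  also have "(\<integral>z. \<bar>fst z - snd z\<bar> powr p \<partial>\<gamma>) \<le> \<eta>"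
    using cost icost nn_integral_eq_integral[OF icost] by simp
  finally show ?thesis using C(1) by (simp add: mult_left_mono)
qed

lemma wasserstein_conv_imp_moment_conv:
  fixes M :: "nat \<Rightarrow> real measure" and P :: "real poly"
  assumes intM: "\<And>n. integrable (M n) (poly P)" and intN: "integrable N (poly P)"
    and bd: "AE x in N. \<bar>x\<bar> \<le> R" and R: "R \<ge> 0"
    and W: "\<And>p. p \<ge> 1 \<Longrightarrow> (\<lambda>n. wasserstein p (M n) N) \<longlonglongrightarrow> 0"
  shows "(\<lambda>n. \<integral>x. poly P x \<partial>M n) \<longlonglongrightarrow> (\<integral>x. poly P x \<partial>N)"
proof (rule tendstoI)
  fix e :: real assume e: "e > 0"
  \<comment> \<open>The exponent must dominate the degree, and convergence is assumed only for
    exponents at least 1.\<close>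
  define p where "p = max 1 (real (degree P))"
  have p: "p \<ge> 1" "real (degree P) \<le> p" by (auto simp: p_def)
  obtain C where C: "C \<ge> 0"
    "\<And>x y. \<bar>y\<bar> \<le> R \<Longrightarrow> \<bar>poly P x - poly P y\<bar> \<le> e / 2 + C * \<bar>x - y\<bar> powr p"
    using poly_diff_le[OF R p(2), of "e / 2"] e by auto
  define \<eta> where "\<eta> = e / (4 * (C + 1))"
  have \<eta>: "\<eta> > 0" "C * \<eta> < e / 2" using e C(1) by (auto simp: \<eta>_def field_simps add_strict_increasing)
  have "(\<lambda>n. INF \<gamma> \<in> couplings (M n) N. \<integral>\<^sup>+ z. ennreal (\<bar>fst z - snd z\<bar> powr p) \<partial>\<gamma>) \<longlonglongrightarrow> 0"
    using W[OF p(1)] p(1) unfolding wasserstein_def Let_def by (subst (asm) tendsto_0_ennreal_root_iff) auto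
  then have "\<forall>\<^sub>F n in sequentially.
      (INF \<gamma> \<in> couplings (M n) N. \<integral>\<^sup>+ z. ennreal (\<bar>fst z - snd z\<bar> powr p) \<partial>\<gamma>) < ennreal \<eta>"
    using \<eta> by (auto simp: tendsto_0_ennreal_iff)
  then show "\<forall>\<^sub>F n in sequentially. dist (\<integral>x. poly P x \<partial>M n) (\<integral>x. poly P x \<partial>N) < e"
  proof eventually_elim
    case (elim n)
    then obtain \<gamma> where "\<gamma> \<in> couplings (M n) N"
      "(\<integral>\<^sup>+ z. ennreal (\<bar>fst z - snd z\<bar> powr p) \<partial>\<gamma>) < ennreal \<eta>"
      by (auto simp: INF_less_iff)
    then have "\<bar>(\<integral>x. poly P x \<partial>M n) - (\<integral>x. poly P x \<partial>N)\<bar> \<le> e / 2 + C * \<eta>"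
      using e \<eta>(1) by (intro coupling_poly_diff[OF _ intM intN bd C]) auto
    then show ?case using \<eta>(2) by (simp add: dist_real_def)
  qed
qed

section \<open>Quantile functions and the quantile coupling\<close>

abbreviation unit_interval :: "real measure" where
  "unit_interval \<equiv> restrict_space lborel {0<..<1}"

lemma prob_space_unit_interval: "prob_space unit_interval"
  by (auto simp: space_restrict_space emeasure_restrict_space intro!: prob_spaceI)

lemma quantile_eq_cdf: "quantile M x = Inf {y. x \<le> cdf M y}"
  by (simp add: quantile_def cdf_def)

lemma quantile_measurable:
  assumes "real_distribution M"
  shows "quantile M \<in> borel_measurable unit_interval"
proof -
  interpret cdf_distribution M using assms by (simp add: cdf_distribution_def)
  have "quantile M = (\<lambda>x. Inf {y. x \<le> cdf M y})" by (simp add: fun_eq_iff quantile_eq_cdf)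
  moreover have "sets unit_interval = sets (restrict_space borel {0<..<1::real})"
    by (intro sets_restrict_space_cong) simp
  ultimately show ?thesis using measurable_CI by (simp cong: measurable_cong_sets)
qed

lemma distr_quantile:
  assumes "real_distribution M"
  shows "distr unit_interval borel (quantile M) = M"
proof -
  interpret cdf_distribution M using assms by (simp add: cdf_distribution_def)
  show ?thesis using distr_I_eq_M by (simp add: quantile_eq_cdf[abs_def])
qed

text \<open>The endpoints form a null set. They are better dropped, because the set defining
  \<open>quantile\<close> is the whole line at 0 and may be empty at 1.\<close>

lemma Lp_cost_unit_interval:
  "(\<integral>\<^sup>+ x \<in> {0..1}. f x \<partial>lborel) = (\<integral>\<^sup>+ x. f x \<partial>unit_interval)"
proof -
  have "(\<integral>\<^sup>+ x. f x \<partial>unit_interval) = (\<integral>\<^sup>+ x. f x * indicator {0<..<1} x \<partial>lborel)"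
    by (rule nn_integral_restrict_space) simp
  also have "\<dots> = (\<integral>\<^sup>+ x. f x * indicator {0..1} x \<partial>lborel)"
    using AE_lborel_singleton[of 0] AE_lborel_singleton[of 1]
    by (intro nn_integral_cong_AE, eventually_elim) (auto split: split_indicator)
  finally show ?thesis ..
qed

lemma quantile_coupling:
  assumes M: "real_distribution M" and N: "real_distribution N"
  shows "distr unit_interval (borel \<Otimes>\<^sub>M borel) (\<lambda>t. (quantile M t, quantile N t)) \<in> couplings M N"
proof -
  note [measurable] = quantile_measurable[OF M] quantile_measurable[OF N]
  show ?thesis
    using distr_quantile[OF M] distr_quantile[OF N]
    by (auto simp: couplings_def distr_distr o_def
        intro!: prob_space.prob_space_distr[OF prob_space_unit_interval])
qed

text \<open>The quantile coupling is one competitor in the infimum, and its cost is the integral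
  that defines the distance of the quantile functions.\<close>

lemma Lp01_conv_imp_wasserstein_conv:
  assumes M: "\<And>n. real_distribution (M n)" and N: "real_distribution N" and p: "p > 0"
    and conv: "(\<lambda>n. Lp01_dist p (quantile (M n)) (quantile N)) \<longlonglongrightarrow> 0"
  shows "(\<lambda>n. wasserstein p (M n) N) \<longlonglongrightarrow> 0"
proof -
  let ?W = "\<lambda>n. INF \<gamma> \<in> couplings (M n) N. \<integral>\<^sup>+ z. ennreal (\<bar>fst z - snd z\<bar> powr p) \<partial>\<gamma>"
  let ?L = "\<lambda>n. \<integral>\<^sup>+ x \<in> {0..1}. ennreal (\<bar>quantile (M n) x - quantile N x\<bar> powr p) \<partial>lborel"
  have "?W n \<le> ?L n" for n
  proof -
    note [measurable] = quantile_measurable[OF M] quantile_measurable[OF N]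
    let ?\<gamma> = "distr unit_interval (borel \<Otimes>\<^sub>M borel) (\<lambda>t. (quantile (M n) t, quantile N t))"
    have "?W n \<le> (\<integral>\<^sup>+ z. ennreal (\<bar>fst z - snd z\<bar> powr p) \<partial>?\<gamma>)"
      by (rule INF_lower) (rule quantile_coupling[OF M N])
    also have "\<dots> = ?L n"
      unfolding Lp_cost_unit_interval by (subst nn_integral_distr) auto
    finally show ?thesis .
  qed
  moreover have "?L \<longlonglongrightarrow> 0"
    using conv p unfolding Lp01_dist_def Let_def by (subst (asm) tendsto_0_ennreal_root_iff) auto
  ultimately have "?W \<longlonglongrightarrow> 0"
    by (intro tendsto_sandwich[of "\<lambda>_. 0" ?W _ ?L]) auto
  then show ?thesis
    using p unfolding wasserstein_def Let_def by (subst tendsto_0_ennreal_root_iff) auto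
qed

section \<open>From moments to quantiles\<close>

text \<open>Weierstrass approximation on an interval [-S, S] with \<open>S > R\<close>. Outside it
  the error grows polynomially and is dominated by a high even power; since
  \<open>R / S < 1\<close>, its coefficient can be so small that the power is negligible on
  [-R, R].\<close>

lemma real_poly_approx_growth:
  fixes f :: "real \<Rightarrow> real"
  assumes cont: "continuous_on UNIV f" and bd: "\<And>x. \<bar>f x\<bar> \<le> 1" and R: "R \<ge> 0" and \<epsilon>: "\<epsilon> > 0"
  obtains P c m where "c \<ge> 0" "c * R ^ (2 * m) \<le> \<epsilon>" "\<And>x. \<bar>f x - poly P x\<bar> \<le> \<epsilon> + c * x ^ (2 * m)"
proof -
  define S where "S = R + 1"
  have S: "S \<ge> 1" "R < S" using R by (auto simp: S_def)
  obtain g where g: "real_polynomial_function g" "\<And>x. x \<in> {-S..S} \<Longrightarrow> \<bar>f x - g x\<bar> < \<epsilon>"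
    using Stone_Weierstrass_real_polynomial_function[of "{-S..S}" f \<epsilon>] cont \<epsilon>
    by (metis compact_Icc continuous_on_subset subset_UNIV)
  obtain a n where an: "g = (\<lambda>x. \<Sum>i\<le>n. a i * x ^ i)"
    using g(1) real_polynomial_function_iff_sum by blast
  define P where "P = (\<Sum>i\<le>n. monom (a i) i)"
  have P: "poly P x = g x" for x by (simp add: P_def an poly_sum poly_monom)
  define k where "k = degree P"
  define K where "K = (\<Sum>i\<le>degree P. \<bar>coeff P i\<bar>)"
  have K: "K \<ge> 0" by (auto simp: K_def intro: sum_nonneg)
  have "(\<lambda>m. (1 + K) * S ^ k * ((R / S)\<^sup>2) ^ m) \<longlonglongrightarrow> (1 + K) * S ^ k * 0"
    using R S by (intro tendsto_mult_left LIMSEQ_realpow_zero) (auto simp: abs_square_less_1)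
  then have "\<forall>\<^sub>F m in sequentially. (1 + K) * S ^ k * ((R / S)\<^sup>2) ^ m < \<epsilon>"
    using \<epsilon> by (intro order_tendstoD(2)) auto
  then obtain m where m: "m \<ge> k" "(1 + K) * S ^ k * ((R / S)\<^sup>2) ^ m < \<epsilon>"
    using eventually_conj[OF eventually_ge_at_top[of k]] by (metis (mono_tags, lifting) eventually_happens' sequentially_bot)
  \<comment> \<open>With this choice \<open>c * x ^ (2 * m)\<close> is
    \<open>(1 + K) * S ^ k\<close> times the power \<open>2 * m\<close> of
    \<open>\<bar>x\<bar> / S\<close>: large enough outside [-S, S] because \<open>m \<ge> k\<close>,
    and small at \<open>R\<close> by the choice of \<open>m\<close>.\<close>
  define c where "c = (1 + K) * S ^ k / S ^ (2 * m)"
  show ?thesis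
  proof (rule that)
    show c: "c \<ge> 0" using K S by (simp add: c_def)
    show "c * R ^ (2 * m) \<le> \<epsilon>"
      using m(2) by (simp add: c_def power_divide power_mult)
    fix x
    show "\<bar>f x - poly P x\<bar> \<le> \<epsilon> + c * x ^ (2 * m)"
    proof (cases "\<bar>x\<bar> \<le> S")
      case True
      then have "\<bar>f x - poly P x\<bar> < \<epsilon>" unfolding P by (intro g(2)) auto
      moreover have "c * x ^ (2 * m) \<ge> 0" using c by (intro mult_nonneg_nonneg) (auto simp: power_mult)
      ultimately show ?thesis by linarith
    next
      case False
      have "\<bar>f x - poly P x\<bar> \<le> \<bar>f x\<bar> + \<bar>poly P x\<bar>" by simp
      also have "\<dots> \<le> 1 + K * \<bar>x\<bar> ^ k"
        using bd[of x] poly_abs_le[of "\<bar>x\<bar>" x P] False S by (simp add: K_def k_def)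
      also have "\<dots> \<le> (1 + K) * \<bar>x\<bar> ^ k"
        using False S by (simp add: algebra_simps one_le_power)
      also have "\<bar>x\<bar> ^ k = S ^ k * (\<bar>x\<bar> / S) ^ k" using S by (simp add: power_divide)
      also have "(1 + K) * (S ^ k * (\<bar>x\<bar> / S) ^ k) \<le> (1 + K) * (S ^ k * (\<bar>x\<bar> / S) ^ (2 * m))"
        using False S K m(1) by (intro mult_left_mono power_increasing) auto
      also have "\<dots> = c * x ^ (2 * m)" by (simp add: c_def power_divide power_even_abs)
      finally show ?thesis using \<epsilon> by simp
    qed
  qed
qed

lemma (in real_distribution) integral_even_power_le:
  assumes bd: "AE x in M. \<bar>x\<bar> \<le> R"
  shows "(\<integral>x. poly (monom 1 (2 * m)) x \<partial>M) \<le> R ^ (2 * m)"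
proof (rule integral_le_const)
  show "integrable M (poly (monom 1 (2 * m)))" by (rule integrable_poly_bounded[OF bd])
  show "AE x in M. poly (monom 1 (2 * m)) x \<le> R ^ (2 * m)"
    using bd
  proof eventually_elim
    case (elim x)
    then have "\<bar>x\<bar> ^ (2 * m) \<le> R ^ (2 * m)" by (intro power_mono) auto
    then show ?case by (simp add: poly_monom power_even_abs)
  qed
qed

text \<open>A bounded continuous \<open>f\<close> is replaced by a polynomial. The error outside the
  support of \<open>N\<close> is bounded by an even moment, which under \<open>M n\<close> tends to
  that under \<open>N\<close> and is therefore eventually small, so no mass escapes.\<close>

lemma moment_conv_imp_weak_conv:
  fixes M :: "nat \<Rightarrow> real measure"
  assumes M: "\<And>n. real_distribution (M n)" and N: "real_distribution N"
    and intM: "\<And>n P. integrable (M n) (poly P)"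
    and bd: "AE x in N. \<bar>x\<bar> \<le> R" and R: "R \<ge> 0"
    and conv: "\<And>P. (\<lambda>n. \<integral>x. poly P x \<partial>M n) \<longlonglongrightarrow> (\<integral>x. poly P x \<partial>N)"
  shows "weak_conv_m M N"
proof (rule integral_bdd_continuous_conv_imp_weak_conv[OF M N])
  fix f :: "real \<Rightarrow> real" assume "\<And>x. isCont f x" and f1: "\<And>x. \<bar>f x\<bar> \<le> 1"
  then have fc: "continuous_on UNIV f" by (simp add: continuous_at_imp_continuous_on)
  then have fm [measurable]: "f \<in> borel_measurable borel" by (rule borel_measurable_continuous_onI)
  interpret N: real_distribution N by (rule N)
  interpret M: real_distribution "M n" for n by (rule M)
  have intN: "integrable N (poly P)" for P by (rule N.integrable_poly_bounded[OF bd])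
  have fN: "integrable N f" by (rule N.integrable_const_bound[of _ 1]) (auto simp: f1)
  have fM: "integrable (M n) f" for n by (rule M.integrable_const_bound[of _ 1]) (auto simp: f1)
  show "(\<lambda>n. \<integral>x. f x \<partial>M n) \<longlonglongrightarrow> (\<integral>x. f x \<partial>N)"
  proof (rule tendstoI)
    fix e :: real assume "e > 0"
    \<comment> \<open>Budget: \<open>\<epsilon>\<close> for the approximation under
      \<open>M n\<close>, \<open>2 * \<epsilon>\<close> for the polynomial moments together with the
      even moment under \<open>M n\<close>, and \<open>2 * \<epsilon>\<close> for the approximation
      under \<open>N\<close>.\<close>
    define \<epsilon> where "\<epsilon> = e / 5"
    have \<epsilon>: "\<epsilon> > 0" using \<open>e > 0\<close> by (simp add: \<epsilon>_def)
    obtain P c m where c: "c \<ge> 0" "c * R ^ (2 * m) \<le> \<epsilon>"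
      and P: "\<And>x. \<bar>f x - poly P x\<bar> \<le> \<epsilon> + c * x ^ (2 * m)"
      by (rule real_poly_approx_growth[OF fc f1 R \<epsilon>]) (rule that)
    let ?Q = "monom 1 (2 * m) :: real poly"
    have P': "\<bar>f x - poly P x\<bar> \<le> \<epsilon> + c * poly ?Q x" for x
      using P[of x] by (simp add: poly_monom)
    have approx: "\<bar>(\<integral>x. f x \<partial>L) - (\<integral>x. poly P x \<partial>L)\<bar> \<le> \<epsilon> + c * (\<integral>x. poly ?Q x \<partial>L)"
      if L: "prob_space L" "integrable L f" "integrable L (poly P)" "integrable L (poly ?Q)" for L
    proof -
      interpret prob_space L by (rule L)
      have "(\<integral>x. f x \<partial>L) - (\<integral>x. poly P x \<partial>L) = (\<integral>x. f x - poly P x \<partial>L)"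
        using L by simp
      also have "\<bar>\<dots>\<bar> \<le> (\<integral>x. \<bar>f x - poly P x\<bar> \<partial>L)" by (rule integral_abs_bound)
      also have "\<dots> \<le> (\<integral>x. \<epsilon> + c * poly ?Q x \<partial>L)"
        using L P' by (intro integral_mono) auto
      also have "\<dots> = \<epsilon> + c * (\<integral>x. poly ?Q x \<partial>L)"
        using L by (simp add: prob_space)
      finally show ?thesis .
    qed
    have "c * (\<integral>x. poly ?Q x \<partial>N) \<le> c * R ^ (2 * m)"
      using c(1) by (intro mult_left_mono N.integral_even_power_le[OF bd])
    then have cN: "c * (\<integral>x. poly ?Q x \<partial>N) \<le> \<epsilon>" using c(2) by simp
    have "(\<lambda>n. \<bar>(\<integral>x. poly P x \<partial>M n) - (\<integral>x. poly P x \<partial>N)\<bar> + c * (\<integral>x. poly ?Q x \<partial>M n))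
        \<longlonglongrightarrow> \<bar>(\<integral>x. poly P x \<partial>N) - (\<integral>x. poly P x \<partial>N)\<bar> + c * (\<integral>x. poly ?Q x \<partial>N)"
      by (intro tendsto_intros conv)
    then have "\<forall>\<^sub>F n in sequentially.
        \<bar>(\<integral>x. poly P x \<partial>M n) - (\<integral>x. poly P x \<partial>N)\<bar> + c * (\<integral>x. poly ?Q x \<partial>M n) < 2 * \<epsilon>"
      by (rule order_tendstoD(2)) (use cN \<epsilon> in auto)
    then show "\<forall>\<^sub>F n in sequentially. dist (\<integral>x. f x \<partial>M n) (\<integral>x. f x \<partial>N) < e"
    proof eventually_elim
      case (elim n)
      have "\<bar>(\<integral>x. f x \<partial>M n) - (\<integral>x. poly P x \<partial>M n)\<bar> \<le> \<epsilon> + c * (\<integral>x. poly ?Q x \<partial>M n)"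
        by (rule approx[OF M.prob_space_axioms fM intM intM])
      moreover have "\<bar>(\<integral>x. f x \<partial>N) - (\<integral>x. poly P x \<partial>N)\<bar> \<le> \<epsilon> + c * (\<integral>x. poly ?Q x \<partial>N)"
        by (rule approx[OF N.prob_space_axioms fN intN intN])
      moreover have "5 * \<epsilon> = e" by (simp add: \<epsilon>_def)
      ultimately show ?case using elim cN unfolding dist_real_def by linarith
    qed
  qed
qed

text \<open>By \<open>pseudoinverse\<close>, bounds on a quantile are bounds on the distribution
  function. Without atoms in \<open>N\<close> the distribution functions converge everywhere;
  \<open>strict\<close> excludes a flat piece to the right of the quantile, where the limit level
  would not be exceeded.\<close>

lemma weak_conv_imp_quantile_conv:
  assumes M: "\<And>n. real_distribution (M n)" and N: "real_distribution N"
    and w: "weak_conv_m M N"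
    and cont: "\<And>x. measure N {x} = 0"
    and strict: "\<And>z. quantile N t < z \<Longrightarrow> t < cdf N z"
    and t: "0 < t" "t < 1"
  shows "(\<lambda>n. quantile (M n) t) \<longlonglongrightarrow> quantile N t"
proof (rule order_tendstoI)
  interpret M: cdf_distribution "M n" for n using M by (simp add: cdf_distribution_def)
  interpret N: cdf_distribution N using N by (simp add: cdf_distribution_def)
  have conv: "(\<lambda>n. cdf (M n) x) \<longlonglongrightarrow> cdf N x" for x
    using w cont by (auto simp: weak_conv_m_def weak_conv_def N.isCont_cdf)
  fix a assume "a < quantile N t"
  then obtain b where b: "a < b" "b < quantile N t" using dense by blast
  then have "cdf N b < t"
    using N.pseudoinverse[OF t, of b] by (simp add: quantile_eq_cdf)
  then have "\<forall>\<^sub>F n in sequentially. cdf (M n) b < t"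
    by (rule order_tendstoD(2)[OF conv])
  then show "\<forall>\<^sub>F n in sequentially. a < quantile (M n) t"
  proof eventually_elim
    case (elim n)
    then show ?case using b M.pseudoinverse[OF t, of n b] by (simp add: quantile_eq_cdf)
  qed
next
  interpret M: cdf_distribution "M n" for n using M by (simp add: cdf_distribution_def)
  interpret N: cdf_distribution N using N by (simp add: cdf_distribution_def)
  have conv: "(\<lambda>n. cdf (M n) x) \<longlonglongrightarrow> cdf N x" for x
    using w cont by (auto simp: weak_conv_m_def weak_conv_def N.isCont_cdf)
  fix a assume "quantile N t < a"
  then obtain b where b: "quantile N t < b" "b < a" using dense by blast
  then have "\<forall>\<^sub>F n in sequentially. t < cdf (M n) b"
    using order_tendstoD(1)[OF conv strict] by blast
  then show "\<forall>\<^sub>F n in sequentially. quantile (M n) t < a"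
  proof eventually_elim
    case (elim n)
    then show ?case using b M.pseudoinverse[OF t, of n b] by (simp add: quantile_eq_cdf)
  qed
qed

text \<open>A uniform integrability argument: the difference truncated at \<open>K\<close> is
  handled by dominated convergence, and the part above \<open>K\<close> costs at most a bounded
  higher moment divided by \<open>K\<close>.\<close>

lemma (in prob_space) bounded_moments_imp_Lp_conv:
  fixes X :: "nat \<Rightarrow> 'a \<Rightarrow> real" and Y :: "'a \<Rightarrow> real"
  assumes X [measurable]: "\<And>n. X n \<in> borel_measurable M" and Y [measurable]: "Y \<in> borel_measurable M"
    and conv: "\<And>t. t \<in> space M \<Longrightarrow> (\<lambda>n. X n t) \<longlonglongrightarrow> Y t"
    and int: "\<And>n j. integrable M (\<lambda>t. X n t ^ (2 * j))"
    and mom: "\<And>j. \<exists>B. \<forall>n. (\<integral>t. X n t ^ (2 * j) \<partial>M) \<le> B"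
    and bd: "AE t in M. \<bar>Y t\<bar> \<le> R" and p: "p > 0"
  shows "(\<lambda>n. \<integral>\<^sup>+ t. ennreal (\<bar>X n t - Y t\<bar> powr p) \<partial>M) \<longlonglongrightarrow> 0"
  unfolding tendsto_0_ennreal_iff
proof (intro allI impI)
  fix e :: real assume e: "e > 0"
  obtain i :: nat where i: "p \<le> real i" using real_arch_simple by blast
  \<comment> \<open>Then \<open>2 * j \<ge> p + 1\<close>, so for distances above \<open>K\<close>
    the p-th power is at most the power \<open>2 * j\<close> divided by \<open>K\<close>.\<close>
  define j where "j = Suc i"
  have j: "p + 1 \<le> real (2 * j)" using i p by (simp add: j_def)
  obtain B where B: "\<And>n. (\<integral>t. X n t ^ (2 * j) \<partial>M) \<le> B" using mom by blast
  define A where "A = 4 ^ j * (\<bar>B\<bar> + R ^ (2 * j))"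
  have A: "A \<ge> 0" by (simp add: A_def)
  \<comment> \<open>Makes the tail bound \<open>A / K\<close> smaller than \<open>e / 2\<close>; the
    maximum with 1 allows comparison of powers.\<close>
  define K where "K = max 1 (2 * A / e + 1)"
  have K: "K \<ge> 1" and AK: "A / K < e / 2"
  proof -
    show "K \<ge> 1" by (simp add: K_def)
    have "2 * A / e < K" by (simp add: K_def)
    then show "A / K < e / 2" using e \<open>K \<ge> 1\<close> by (simp add: field_simps)
  qed
  define g where "g n t = min \<bar>X n t - Y t\<bar> K powr p" for n t
  have gm [measurable]: "g n \<in> borel_measurable M" for n unfolding g_def by measurable
  have g: "\<bar>g n t\<bar> \<le> K powr p" for n t
    unfolding g_def abs_of_nonneg[OF powr_ge_zero] using p K by (intro powr_mono2) auto
  have gint: "integrable M (g n)" for n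
    by (rule integrable_const_bound[of _ "K powr p"]) (auto simp: g)
  have "(\<lambda>n. \<integral>t. g n t \<partial>M) \<longlonglongrightarrow> (\<integral>t. 0 \<partial>M)"
  proof (rule integral_dominated_convergence[where w = "\<lambda>_. K powr p"])
    show "AE t in M. (\<lambda>n. g n t) \<longlonglongrightarrow> 0"
    proof (rule AE_I2)
      fix t assume "t \<in> space M"
      then have "(\<lambda>n. min \<bar>X n t - Y t\<bar> K) \<longlonglongrightarrow> min \<bar>Y t - Y t\<bar> K"
        by (intro tendsto_intros conv)
      then have "(\<lambda>n. min \<bar>X n t - Y t\<bar> K) \<longlonglongrightarrow> 0" using K by (simp add: min_def)
      then have "(\<lambda>n. min \<bar>X n t - Y t\<bar> K powr p) \<longlonglongrightarrow> 0 powr p"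
        using p K by (intro tendsto_powr') auto
      then show "(\<lambda>n. g n t) \<longlonglongrightarrow> 0" using p by (simp add: g_def)
    qed
  qed (auto simp: g)
  then have "\<forall>\<^sub>F n in sequentially. (\<integral>t. g n t \<partial>M) < e / 2"
    using e by (intro order_tendstoD(2)) auto
  then show "\<forall>\<^sub>F n in sequentially. (\<integral>\<^sup>+ t. ennreal (\<bar>X n t - Y t\<bar> powr p) \<partial>M) < ennreal e"
  proof eventually_elim
    case (elim n)
    let ?h = "\<lambda>t. g n t + 4 ^ j / K * (X n t ^ (2 * j) + R ^ (2 * j))"
    have hint: "integrable M ?h" by (intro Bochner_Integration.integrable_add integrable_mult_right gint int) simp
    have le: "AE t in M. \<bar>X n t - Y t\<bar> powr p \<le> ?h t"
      using bd
    proof eventually_elim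
      case (elim t)
      let ?d = "\<bar>X n t - Y t\<bar>"
      have pow: "?d ^ (2 * j) \<le> 4 ^ j * (X n t ^ (2 * j) + R ^ (2 * j))"
      proof -
        have "?d \<le> 2 * max \<bar>X n t\<bar> R" using elim by linarith
        then have "?d ^ (2 * j) \<le> (2 * max \<bar>X n t\<bar> R) ^ (2 * j)" by (intro power_mono) auto
        also have "\<dots> = 4 ^ j * max \<bar>X n t\<bar> R ^ (2 * j)"
          by (simp add: power_mult_distrib power_mult)
        also have "max \<bar>X n t\<bar> R ^ (2 * j) \<le> X n t ^ (2 * j) + R ^ (2 * j)"
          by (auto simp: max_def power_mult)
        finally show ?thesis by simp
      qed
      have nn: "4 ^ j / K * (X n t ^ (2 * j) + R ^ (2 * j)) \<ge> 0"
        using K by (intro mult_nonneg_nonneg add_nonneg_nonneg) (auto simp: power_mult)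
      show ?case
      proof (cases "?d \<le> K")
        case True
        then show ?thesis using nn by (simp add: g_def min_def)
      next
        case False
        then have d: "?d > K" by simp
        have "?d powr p * K \<le> ?d powr p * ?d powr 1"
          using d K by (intro mult_left_mono) auto
        also have "\<dots> = ?d powr (p + 1)" by (simp add: powr_add)
        also have "\<dots> \<le> ?d powr (2 * j)" using d K j by (intro powr_mono) auto
        also have "\<dots> = ?d ^ (2 * j)" using d K by (subst powr_realpow) auto
        also note pow
        finally have "?d powr p \<le> 4 ^ j / K * (X n t ^ (2 * j) + R ^ (2 * j))"
          using K by (simp add: field_simps)
        then show ?thesis by (simp add: g_def add_increasing)
      qed
    qed
    have "(\<integral>t. ?h t \<partial>M) = (\<integral>t. g n t \<partial>M) + 4 ^ j / K * ((\<integral>t. X n t ^ (2 * j) \<partial>M) + R ^ (2 * j))"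
      using gint int by (simp add: prob_space)
    also have "\<dots> \<le> (\<integral>t. g n t \<partial>M) + A / K"
    proof -
      have "4 ^ j * ((\<integral>t. X n t ^ (2 * j) \<partial>M) + R ^ (2 * j)) \<le> A"
        unfolding A_def using B[of n] by (intro mult_left_mono) auto
      then show ?thesis using K by (simp add: divide_right_mono)
    qed
    also have "\<dots> < e" using elim AK by linarith
    finally have "(\<integral>t. ?h t \<partial>M) < e" .
    have "(\<integral>\<^sup>+ t. ennreal (\<bar>X n t - Y t\<bar> powr p) \<partial>M) \<le> (\<integral>\<^sup>+ t. ennreal (?h t) \<partial>M)"
      using le by (intro nn_integral_mono_AE) (auto elim!: eventually_mono intro: ennreal_leI)
    also have "\<dots> = ennreal (\<integral>t. ?h t \<partial>M)"
      using hint le by (intro nn_integral_eq_integral) (auto elim!: eventually_mono intro: order_trans[OF powr_ge_zero])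
    also have "\<dots> < ennreal e" using \<open>(\<integral>t. ?h t \<partial>M) < e\<close> e by (rule ennreal_lessI[rotated])
    finally show ?case .
  qed
qed

lemma moment_conv_imp_Lp01_conv:
  fixes M :: "nat \<Rightarrow> real measure"
  assumes M: "\<And>n. real_distribution (M n)" and N: "real_distribution N"
    and intM: "\<And>n P. integrable (M n) (poly P)"
    and bd: "AE x in N. \<bar>x\<bar> \<le> R" and R: "R \<ge> 0"
    and cont: "\<And>x. measure N {x} = 0"
    and strict: "\<And>t z. 0 < t \<Longrightarrow> t < 1 \<Longrightarrow> quantile N t < z \<Longrightarrow> t < cdf N z"
    and conv: "\<And>P. (\<lambda>n. \<integral>x. poly P x \<partial>M n) \<longlonglongrightarrow> (\<integral>x. poly P x \<partial>N)"
    and p: "p > 0"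
  shows "(\<lambda>n. Lp01_dist p (quantile (M n)) (quantile N)) \<longlonglongrightarrow> 0"
proof -
  interpret U: prob_space unit_interval by (rule prob_space_unit_interval)
  note qM [measurable] = quantile_measurable[OF M] and qN [measurable] = quantile_measurable[OF N]
  have w: "weak_conv_m M N"
    by (rule moment_conv_imp_weak_conv[OF M N intM bd R conv])
  have "(\<lambda>n. \<integral>\<^sup>+ t. ennreal (\<bar>quantile (M n) t - quantile N t\<bar> powr p) \<partial>unit_interval) \<longlonglongrightarrow> 0"
  proof (rule U.bounded_moments_imp_Lp_conv[OF qM qN _ _ _ _ p])
    show "(\<lambda>n. quantile (M n) t) \<longlonglongrightarrow> quantile N t" if "t \<in> space unit_interval" for t
      using that by (intro weak_conv_imp_quantile_conv[OF M N w cont strict]) (auto simp: space_restrict_space)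
    \<comment> \<open>The moments of the quantile function are those of the measure itself, hence
      bounded in \<open>n\<close> because they converge.\<close>
    have eq: "integrable unit_interval (\<lambda>t. quantile (M n) t ^ k) \<and>
        (\<integral>t. quantile (M n) t ^ k \<partial>unit_interval) = (\<integral>x. poly (monom 1 k) x \<partial>M n)" for n k
    proof -
      have "poly (monom 1 k) = (\<lambda>x :: real. x ^ k)" by (simp add: fun_eq_iff poly_monom)
      then have "integrable (distr unit_interval borel (quantile (M n))) (\<lambda>x. x ^ k)"
        using intM[of n "monom 1 k"] unfolding distr_quantile[OF M] by simp
      then have "integrable unit_interval (\<lambda>t. quantile (M n) t ^ k)"
        by (subst (asm) integrable_distr_eq) auto
      moreover have "(\<integral>x. x ^ k \<partial>distr unit_interval borel (quantile (M n))) =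
          (\<integral>t. quantile (M n) t ^ k \<partial>unit_interval)"
        by (subst integral_distr) auto
      ultimately show ?thesis unfolding distr_quantile[OF M] by (simp add: poly_monom)
    qed
    show "integrable unit_interval (\<lambda>t. quantile (M n) t ^ (2 * j))" for n j
      using eq by blast
    show "\<exists>B. \<forall>n. (\<integral>t. quantile (M n) t ^ (2 * j) \<partial>unit_interval) \<le> B" for j
    proof -
      have "Bseq (\<lambda>n. \<integral>x. poly (monom 1 (2 * j)) x \<partial>M n)"
        using conv convergentI convergent_imp_Bseq by blast
      then obtain B where "\<And>n. norm (\<integral>x. poly (monom 1 (2 * j)) x \<partial>M n) \<le> B"
        by (auto simp: Bseq_def)
      then show ?thesis using eq by (intro exI[of _ B]) (auto simp: abs_le_iff)
    qed
    have "AE x in distr unit_interval borel (quantile N). \<bar>x\<bar> \<le> R"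
      using bd unfolding distr_quantile[OF N] .
    then show "AE t in unit_interval. \<bar>quantile N t\<bar> \<le> R"
      by (subst (asm) AE_distr_iff) auto
  qed
  then show ?thesis
    using p unfolding Lp01_dist_def Let_def Lp_cost_unit_interval[symmetric]
    by (subst tendsto_0_ennreal_root_iff) auto
qed

text \<open>Otherwise the distribution function is constantly \<open>t\<close> from the quantile up
  to \<open>z\<close>. As \<open>0 < t < 1\<close>, this null interval meets (-2, 2) in an interval,
  which has positive mass.\<close>

lemma semicircle_quantile_strict:
  assumes t: "0 < t" "t < 1" and z: "quantile semicircle t < z"
  shows "t < cdf semicircle z"
proof (rule ccontr)
  interpret cdf_distribution semicircle
    using real_distribution_semicircle by (simp add: cdf_distribution_def)
  let ?y = "quantile semicircle t"
  assume "\<not> t < cdf semicircle z"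
  moreover have ty: "t \<le> cdf semicircle ?y"
    using pseudoinverse[OF t, of ?y] by (simp add: quantile_eq_cdf)
  moreover have "cdf semicircle ?y \<le> cdf semicircle z" using z by (intro cdf_nondecreasing) simp
  moreover have "cdf semicircle z - cdf semicircle ?y = measure semicircle {?y<..z}"
    by (rule cdf_diff_eq[OF z])
  ultimately have zero: "measure semicircle {?y<..z} = 0" and eq: "cdf semicircle z = t" "cdf semicircle ?y = t"
    by auto
  have "?y < 2"
  proof (rule ccontr)
    assume "\<not> ?y < 2"
    then have "AE x in semicircle. x \<in> {..?y}"
      using AE_semicircle by (auto elim!: eventually_mono)
    then have "cdf semicircle ?y = 1" unfolding cdf_def by (subst prob_eq_1) auto
    then show False using eq t by simp
  qed
  moreover have "z > -2"
  proof (rule ccontr)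
    assume "\<not> z > -2"
    have "{-2} \<in> null_sets semicircle"
      using measure_semicircle_singleton[of "-2"] by (auto simp: null_sets_def emeasure_eq_measure)
    then have "AE x in semicircle. x \<notin> {-2}" by (rule AE_not_in)
    then have "AE x in semicircle. x \<notin> {..z}"
      using AE_semicircle by eventually_elim (use \<open>\<not> z > -2\<close> in auto)
    then have "cdf semicircle z = 0" unfolding cdf_def by (subst prob_eq_0) auto
    then show False using eq t by simp
  qed
  ultimately have "measure semicircle {max ?y (-2)<..min z 2} > 0"
    using z by (intro measure_semicircle_interval_pos) auto
  also have "measure semicircle {max ?y (-2)<..min z 2} \<le> measure semicircle {?y<..z}"
    by (intro finite_measure_mono) auto
  finally show False using zero by simp
qed

section \<open>Spectral measures of regular graphs\<close>

lemma sum_mset_eq_sum_count: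
  fixes f :: "'a \<Rightarrow> real"
  assumes "finite S" "set_mset A \<subseteq> S"
  shows "(\<Sum>x\<in>#A. f x) = (\<Sum>x\<in>S. real (count A x) * f x)"
  using assms(2)
proof (induction A)
  case (add y A)
  have "(\<Sum>x\<in>S. real (count (add_mset y A) x) * f x) =
      (\<Sum>x\<in>S. real (count A x) * f x + (if x = y then f x else 0))"
    by (intro sum.cong) (auto simp: algebra_simps)
  also have "\<dots> = (\<Sum>x\<in>S. real (count A x) * f x) + f y"
    using add.prems assms(1) by (simp add: sum.distrib)
  finally show ?case using add by simp
qed simp

lemma spectral_measure_integral:
  fixes f :: "real \<Rightarrow> real"
  assumes ne: "adj_eigs G \<noteq> {#}" and [measurable]: "f \<in> borel_measurable borel"
  shows "integrable (spectral_measure q G) f"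
    and "(\<integral>x. f x \<partial>spectral_measure q G) =
      (\<Sum>x\<in>#adj_eigs G. f (x / sqrt (real q))) / real (size (adj_eigs G))"
    and "real_distribution (spectral_measure q G)"
proof -
  define A where "A = image_mset (\<lambda>x. x / sqrt (real q)) (adj_eigs G)"
  have A: "A \<noteq> {#}" using ne by (simp add: A_def)
  have sm: "spectral_measure q G = distr (measure_pmf (pmf_of_multiset A)) borel (\<lambda>x. x)"
    by (simp add: spectral_measure_def A_def)
  have fin: "finite (set_pmf (pmf_of_multiset A))" using A by simp
  show "integrable (spectral_measure q G) f"
    unfolding sm using integrable_measure_pmf_finite[OF fin] by (subst integrable_distr_eq) auto
  show "real_distribution (spectral_measure q G)"
    unfolding sm by (intro prob_space.real_distribution_distr prob_space_measure_pmf) simp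
  have "(\<integral>x. f x \<partial>spectral_measure q G) = (\<integral>x. f x \<partial>measure_pmf (pmf_of_multiset A))"
    unfolding sm by (subst integral_distr) auto
  also have "\<dots> = (\<Sum>x\<in>set_mset A. f x * pmf (pmf_of_multiset A) x)"
    using A by (subst integral_measure_pmf_real[of "set_mset A"]) auto
  also have "\<dots> = (\<Sum>x\<in>set_mset A. real (count A x) * f x) / real (size A)"
    using A by (simp add: sum_divide_distrib mult.commute)
  also have "(\<Sum>x\<in>set_mset A. real (count A x) * f x) = (\<Sum>x\<in>#A. f x)"
    by (rule sum_mset_eq_sum_count[symmetric]) simp_all
  finally show "(\<integral>x. f x \<partial>spectral_measure q G) =
      (\<Sum>x\<in>#adj_eigs G. f (x / sqrt (real q))) / real (size (adj_eigs G))"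
    by (simp add: A_def image_mset.compositionality o_def)
qed


text \<open>The Chebyshev polynomials span all polynomials. The induction on \<open>P\<close> proves
  convergence for every product \<open>P * cheb_U r\<close>, since multiplication of
  \<open>cheb_U r\<close> by the variable yields \<open>cheb_U (r + 1) + cheb_U (r - 1)\<close>
  (only the first term for \<open>r = 0\<close>).\<close>

lemma moment_conv_cheb_U:
  fixes M :: "nat \<Rightarrow> real measure"
  assumes intM: "\<And>n P. integrable (M n) (poly P)" and intN: "\<And>P. integrable N (poly P)"
    and conv: "\<And>r. (\<lambda>n. \<integral>x. poly (cheb_U r) x \<partial>M n) \<longlonglongrightarrow> (\<integral>x. poly (cheb_U r) x \<partial>N)"
  shows "(\<lambda>n. \<integral>x. poly P x \<partial>M n) \<longlonglongrightarrow> (\<integral>x. poly P x \<partial>N)"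
proof -
  let ?C = "\<lambda>P. (\<lambda>n. \<integral>x. poly P x \<partial>M n) \<longlonglongrightarrow> (\<integral>x. poly P x \<partial>N)"
  have add: "?C (P + Q)" if "?C P" "?C Q" for P Q
    using tendsto_add[OF that] intM intN by simp
  have smult: "?C (Polynomial.smult a P)" if "?C P" for a P
    using tendsto_mult_left[OF that, of a] by simp
  have "?C (P * cheb_U r)" for r
  proof (induction P arbitrary: r)
    case (pCons a P)
    have "?C (P * ([:0, 1:] * cheb_U r))"
    proof (cases r)
      case 0
      then have "[:0, 1:] * cheb_U r = cheb_U (Suc 0)" by simp
      then show ?thesis using pCons(2)[of "Suc 0"] by simp
    next
      case (Suc r')
      then have "[:0, 1:] * cheb_U r = cheb_U (Suc (Suc r')) + cheb_U r'" by simp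
      then have "P * ([:0, 1:] * cheb_U r) = P * cheb_U (Suc (Suc r')) + P * cheb_U r'"
        by (simp only: distrib_left)
      then show ?thesis using add[OF pCons(2)[of "Suc (Suc r')"] pCons(2)[of r']] by simp
    qed
    moreover have "pCons a P * cheb_U r = Polynomial.smult a (cheb_U r) + P * ([:0, 1:] * cheb_U r)"
      by (simp add: mult_pCons_left)
    ultimately show ?case using add[OF smult[OF conv[of r], of a], of "P * ([:0, 1:] * cheb_U r)"]
      by (simp only:)
  next
    case 0
    then show ?case using smult[OF conv[of 0], of 0] by simp
  qed
  from this[of 0] show ?thesis by simp
qed

section \<open>Normalized walk counts as Chebyshev moments\<close>

context fin_bidirected_digraph
begin

lemma spectral_measure_moments:
  assumes ne: "verts G \<noteq> {}"
  shows "integrable (spectral_measure q G) (poly P)"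
    and "(\<integral>x. poly P x \<partial>spectral_measure q G) =
      (\<Sum>x\<in>#adj_eigs G. poly P (x / sqrt (real q))) / real (card (verts G))"
    and "real_distribution (spectral_measure q G)"
proof -
  have "adj_eigs G \<noteq> {#}"
  proof
    assume "adj_eigs G = {#}"
    then have "card (verts G) = 0" using size_adj_eigs by simp
    then show False using ne by simp
  qed
  from spectral_measure_integral[OF this, of "poly P" q]
  show "integrable (spectral_measure q G) (poly P)"
    and "(\<integral>x. poly P x \<partial>spectral_measure q G) =
      (\<Sum>x\<in>#adj_eigs G. poly P (x / sqrt (real q))) / real (card (verts G))"
    and "real_distribution (spectral_measure q G)"
    by (simp_all add: size_adj_eigs)
qed

text \<open>This is \<open>f_count_eigenvalues\<close> divided by \<open>s ^ r\<close> times the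
  number of vertices, with the eigenvalues rescaled by \<open>s = sqrt q\<close> and
  \<open>nb_val\<close> expressed through \<open>cheb_U\<close>.\<close>

lemma f_count_cheb_U:
  assumes ne: "verts G \<noteq> {}" and q: "q \<ge> 1" and reg: "regular_deg G (q + 1)"
  defines "F \<equiv> \<lambda>r. real q powr (- real r / 2) * real (f_count G arev r) / real (card (verts G))"
    and "I \<equiv> \<lambda>r. \<integral>x. poly (cheb_U r) x \<partial>spectral_measure q G"
  shows "F 1 = I 1" and "F (Suc (Suc r)) = I (Suc (Suc r)) - I r / real q" and "I 0 = 1"
proof -
  define s where "s = sqrt (real q)"
  have s: "s > 0" "s\<^sup>2 = real q" using q by (auto simp: s_def)
  have V: "real (card (verts G)) > 0" using ne by (simp add: card_gt_0_iff)
  have I: "I r = (\<Sum>x\<in>#adj_eigs G. poly (cheb_U r) (x / s)) / real (card (verts G))" for r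
    unfolding I_def s_def by (rule spectral_measure_moments(2)[OF ne])
  have F: "F r = (\<Sum>x\<in>#adj_eigs G. nb_val (real q) x r) / s ^ r / real (card (verts G))" if "r \<ge> 1" for r
  proof -
    have "real q powr (real r / 2) = (real q powr (1 / 2)) powr real r" by (simp add: powr_powr)
    also have "real q powr (1 / 2) = s" unfolding s_def by (rule powr_half_sqrt) simp
    also have "s powr real r = s ^ r" by (rule powr_realpow[OF s(1)])
    finally have "real q powr (- (real r / 2)) = inverse (s ^ r)" by (simp only: powr_minus)
    then show ?thesis
      unfolding F_def f_count_eigenvalues[OF reg that] minus_divide_left
      by (simp only: divide_inverse mult.commute)
  qed
  have "(\<Sum>x\<in>#A. x) / s = (\<Sum>x\<in>#A. x / s)" for A
    by (induction A) (auto simp: add_divide_distrib)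
  then show "F 1 = I 1" unfolding I F[OF le_refl] by simp
  have distrib: "(\<Sum>x\<in>#A. c * (f x - g x / d)) = c * ((\<Sum>x\<in>#A. f x) - (\<Sum>x\<in>#A. g x) / d)"
    for A and c d :: real and f g :: "real \<Rightarrow> real"
    by (induction A) (auto simp: algebra_simps add_divide_distrib)
  have "nb_val (real q) x (Suc (Suc r)) = s ^ Suc (Suc r) *
      (poly (cheb_U (Suc (Suc r))) (x / s) - poly (cheb_U r) (x / s) / real q)" for x
    using nb_val_eq_cheb_U[OF s(1), of "x / s" r] s by (simp del: nb_val.simps cheb_U.simps power_Suc)
  then have "(\<Sum>x\<in>#adj_eigs G. nb_val (real q) x (Suc (Suc r))) = s ^ Suc (Suc r) *
      ((\<Sum>x\<in>#adj_eigs G. poly (cheb_U (Suc (Suc r))) (x / s)) -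
       (\<Sum>x\<in>#adj_eigs G. poly (cheb_U r) (x / s)) / real q)"
    by (simp only: distrib)
  then show "F (Suc (Suc r)) = I (Suc (Suc r)) - I r / real q"
    using s V F[of "Suc (Suc r)"] unfolding I
    by (simp add: diff_divide_distrib del: nb_val.simps cheb_U.simps power_Suc)
  show "I 0 = 1" using ne by (simp add: I size_adj_eigs)
qed

text \<open>In the last bound the two removed arcs contribute a factor 1/q to the normalization and
  \<open>q + 1\<close> to the count, and (q + 1)/q is at most 2.\<close>

lemma c_count_normalized_bounds:
  assumes ne: "verts G \<noteq> {}" and q: "q \<ge> 1" and reg: "regular_deg G (q + 1)"
  defines "F \<equiv> \<lambda>r. real q powr (- real r / 2) * real (f_count G arev r) / real (card (verts G))"
    and "C \<equiv> \<lambda>r. real q powr (- real r / 2) * real (c_count G arev r) / real (card (verts G))"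
  shows "0 \<le> F r" "0 \<le> C r" "C r \<le> F r" "F 1 = C 1" "F 2 = C 2"
    and "r \<ge> 1 \<Longrightarrow> F (r + 2) \<le> C (r + 2) + 2 * F r"
proof -
  show "0 \<le> F r" "0 \<le> C r" "F 1 = C 1" "F 2 = C 2"
    unfolding F_def C_def using c_count_1 c_count_2 by simp_all
  show "C r \<le> F r"
    unfolding F_def C_def using c_count_le_f_count[of r] by (intro divide_right_mono mult_left_mono) simp_all
  assume r: "r \<ge> 1"
  have "real (f_count G arev (r + 2)) \<le> real (c_count G arev (r + 2)) + real (q + 1) * real (f_count G arev r)"
    using f_count_le_c_count[OF reg r] by (metis of_nat_add of_nat_le_iff of_nat_mult)
  then have "F (r + 2) \<le> real q powr (- real (r + 2) / 2) *
      (real (c_count G arev (r + 2)) + real (q + 1) * real (f_count G arev r)) / real (card (verts G))"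
    unfolding F_def by (intro divide_right_mono mult_left_mono) simp_all
  also have "\<dots> = C (r + 2) + real (q + 1) / real q * F r"
  proof -
    have "- real (r + 2) / 2 = - real r / 2 - 1" by (simp add: field_simps)
    then have "real q powr (- real (r + 2) / 2) = real q powr (- real r / 2) / real q"
      using q by (simp only: powr_diff) simp
    then show ?thesis unfolding F_def C_def by (simp add: algebra_simps add_divide_distrib)
  qed
  also have "\<dots> \<le> C (r + 2) + 2 * F r"
    using q by (intro add_left_mono mult_right_mono) (auto simp: F_def field_simps)
  finally show "F (r + 2) \<le> C (r + 2) + 2 * F r" .
qed

end

text \<open>Fits the removal of a tail, which shortens a walk by 2; the base cases are the lengths
  at which circuits and closed walks agree.\<close>

lemma nat_induct_step2 [consumes 1, case_names 1 2 step]: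
  fixes r :: nat
  assumes "r \<ge> 1" "P 1" "P 2" "\<And>r. r \<ge> 1 \<Longrightarrow> P r \<Longrightarrow> P (r + 2)"
  shows "P r"
  using assms(1)
proof (induction r rule: less_induct)
  case (less r)
  consider "r = 1" | "r = 2" | "r \<ge> 3" using less(2) by linarith
  then show ?case
  proof cases
    case 3
    then have "P (r - 2)" using less(1)[of "r - 2"] by simp
    then have "P (r - 2 + 2)" using 3 by (intro assms(4)) simp_all
    moreover have "r - 2 + 2 = r" using 3 by simp
    ultimately show ?thesis by (simp only:)
  qed (use assms(2,3) in simp_all)
qed

section \<open>Assembly of the five equivalent conditions\<close>

theorem theorem4p2:
  fixes G :: "nat \<Rightarrow> ('v,'e) pre_digraph"
    and arev :: "nat \<Rightarrow> 'e \<Rightarrow> 'e"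
    and q :: "nat \<Rightarrow> nat"
  assumes fin: "\<And>n. fin_digraph (G n)"
    and bidir: "\<And>n. bidirected_digraph (G n) (arev n)"
    and nonempty: "\<And>n. verts (G n) \<noteq> {}"
    and qpos: "\<And>n. q n \<ge> 1"
    and reg: "\<And>n. regular_deg (G n) (q n + 1)"
  defines "\<mu> \<equiv> \<lambda>n. spectral_measure (q n) (G n)"
  shows
    "((\<forall>p::real. p \<ge> 1 \<longrightarrow> ((\<lambda>n. wasserstein p (\<mu> n) semicircle) \<longlongrightarrow> 0) sequentially)
      \<longleftrightarrow> (\<forall>p::real. p \<ge> 1 \<longrightarrow>
            ((\<lambda>n. Lp01_dist p (quantile (\<mu> n)) (quantile semicircle)) \<longlongrightarrow> 0) sequentially))
   \<and> ((\<forall>p::real. p \<ge> 1 \<longrightarrow>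
            ((\<lambda>n. Lp01_dist p (quantile (\<mu> n)) (quantile semicircle)) \<longlongrightarrow> 0) sequentially)
      \<longleftrightarrow> (\<forall>P :: real poly.
            ((\<lambda>n. \<integral>x. poly P x \<partial>\<mu> n) \<longlongrightarrow> (\<integral>x. poly P x \<partial>semicircle)) sequentially))
   \<and> ((\<forall>P :: real poly.
            ((\<lambda>n. \<integral>x. poly P x \<partial>\<mu> n) \<longlongrightarrow> (\<integral>x. poly P x \<partial>semicircle)) sequentially)
      \<longleftrightarrow> (filterlim q at_top sequentially \<and>
           (\<forall>r::nat. r \<ge> 1 \<longrightarrow>
             ((\<lambda>n. real (q n) powr (- real r / 2) * real (c_count (G n) (arev n) r)
                     / real (card (verts (G n)))) \<longlongrightarrow> 0) sequentially)))
   \<and> ((filterlim q at_top sequentially \<and>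
           (\<forall>r::nat. r \<ge> 1 \<longrightarrow>
             ((\<lambda>n. real (q n) powr (- real r / 2) * real (c_count (G n) (arev n) r)
                     / real (card (verts (G n)))) \<longlongrightarrow> 0) sequentially))
      \<longleftrightarrow> (filterlim q at_top sequentially \<and>
           (\<forall>r::nat. r \<ge> 1 \<longrightarrow>
             ((\<lambda>n. real (q n) powr (- real r / 2) * real (f_count (G n) (arev n) r)
                     / real (card (verts (G n)))) \<longlongrightarrow> 0) sequentially)))"
proof -
  interpret g: fin_bidirected_digraph "G n" "arev n" for n
    using fin bidir by (simp add: fin_bidirected_digraph_def)
  define I where "I n r = (\<integral>x. poly (cheb_U r) x \<partial>\<mu> n)" for n r
  define F where "F n r = real (q n) powr (- real r / 2) * real (f_count (G n) (arev n) r)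
    / real (card (verts (G n)))" for n r
  define C where "C n r = real (q n) powr (- real r / 2) * real (c_count (G n) (arev n) r)
    / real (card (verts (G n)))" for n r
  have F1: "F n 1 = I n 1" and F_step: "F n (Suc (Suc r)) = I n (Suc (Suc r)) - I n r / real (q n)"
    and I0: "I n 0 = 1" for n r
    unfolding F_def I_def \<mu>_def by (rule g.f_count_cheb_U[OF nonempty qpos reg])+
  have bounds: "0 \<le> F n r" "0 \<le> C n r" "C n r \<le> F n r" "F n 1 = C n 1" "F n 2 = C n 2"
    "r \<ge> 1 \<Longrightarrow> F n (r + 2) \<le> C n (r + 2) + 2 * F n r" for n r
    unfolding F_def C_def by (rule g.c_count_normalized_bounds[OF nonempty qpos reg]; assumption?)+
  have M: "real_distribution (\<mu> n)" and intM: "integrable (\<mu> n) (poly P)" for n P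
    unfolding \<mu>_def using g.spectral_measure_moments[OF nonempty] by auto
  note N = real_distribution_semicircle
  have intN: "integrable semicircle (poly P)" for P
    by (rule real_distribution.integrable_poly_bounded[OF N AE_semicircle])

  let ?i = "\<forall>p::real. p \<ge> 1 \<longrightarrow> (\<lambda>n. wasserstein p (\<mu> n) semicircle) \<longlonglongrightarrow> 0"
  let ?ii = "\<forall>p::real. p \<ge> 1 \<longrightarrow> (\<lambda>n. Lp01_dist p (quantile (\<mu> n)) (quantile semicircle)) \<longlonglongrightarrow> 0"
  let ?iii = "\<forall>P :: real poly. (\<lambda>n. \<integral>x. poly P x \<partial>\<mu> n) \<longlonglongrightarrow> (\<integral>x. poly P x \<partial>semicircle)"
  let ?iv = "filterlim q at_top sequentially \<and> (\<forall>r::nat. r \<ge> 1 \<longrightarrow> (\<lambda>n. C n r) \<longlonglongrightarrow> 0)"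
  let ?v = "filterlim q at_top sequentially \<and> (\<forall>r::nat. r \<ge> 1 \<longrightarrow> (\<lambda>n. F n r) \<longlonglongrightarrow> 0)"

  have "?i \<Longrightarrow> ?iii"
    using wasserstein_conv_imp_moment_conv[OF intM intN AE_semicircle] by simp
  moreover have "?iii \<Longrightarrow> ?ii"
    using moment_conv_imp_Lp01_conv[OF M N intM AE_semicircle _ measure_semicircle_singleton
        semicircle_quantile_strict] by simp
  moreover have "?ii \<Longrightarrow> ?i"
    using Lp01_conv_imp_wasserstein_conv[OF M N] by simp
  moreover have "?v" if iii: ?iii
  proof -
    have I: "(\<lambda>n. I n r) \<longlonglongrightarrow> (if r = 0 then 1 else 0)" for r
      using iii[rule_format, of "cheb_U r"] unfolding I_def integral_semicircle_cheb_U .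
    have q0: "(\<lambda>n. inverse (real (q n))) \<longlonglongrightarrow> 0"
    proof (rule tendsto_sandwich[of "\<lambda>_. 0" _ _ "\<lambda>n. I n 2"])
      \<comment> \<open>The normalized count of length 2 equals \<open>I n 2 - 1 / q\<close> and is
        nonnegative, while \<open>I n 2\<close> tends to 0.\<close>
      have "inverse (real (q n)) \<le> I n 2" for n
        using F_step[of n 0] bounds(1)[of n 2] by (simp add: I0 numeral_2_eq_2 inverse_eq_divide)
      then show "\<forall>\<^sub>F n in sequentially. inverse (real (q n)) \<le> I n 2" by simp
      show "(\<lambda>n. I n 2) \<longlonglongrightarrow> 0" using I[of 2] by simp
    qed auto
    have pos: "real (q n) > 0" for n using qpos[of n] by simp
    have "filterlim (\<lambda>n. real (q n)) at_top sequentially"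
      using filterlim_inverse_at_top[OF q0] pos by simp
    then have "filterlim q at_top sequentially"
      by (simp add: filterlim_sequentially_iff_filterlim_real)
    moreover have "(\<lambda>n. F n r) \<longlonglongrightarrow> 0" if "r \<ge> 1" for r
    proof (cases "r = 1")
      case True
      then show ?thesis using I[of 1] F1 by simp
    next
      case False
      define s where "s = r - 2"
      have s: "r = Suc (Suc s)" using False \<open>r \<ge> 1\<close> by (simp add: s_def)
      have "(\<lambda>n. I n (Suc (Suc s)) - I n s * inverse (real (q n))) \<longlonglongrightarrow>
          (if Suc (Suc s) = 0 then 1 else 0) - (if s = 0 then 1 else 0) * 0"
        by (intro tendsto_intros I q0)
      then show ?thesis unfolding s F_step by (simp add: divide_inverse)
    qed
    ultimately show ?v by blast
  qed
  moreover have "?iii" if v: ?v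
  proof -
    have q0: "(\<lambda>n. inverse (real (q n))) \<longlonglongrightarrow> 0"
      using v by (intro tendsto_inverse_0_at_top) (simp add: filterlim_sequentially_iff_filterlim_real)
    have F: "(\<lambda>n. F n r) \<longlonglongrightarrow> 0" if "r \<ge> 1" for r using v that by blast
    \<comment> \<open>The relation between counts and Chebyshev moments is solved for
      \<open>I n r\<close>, where the earlier moment is damped by 1/q.\<close>
    have I: "(\<lambda>n. I n r) \<longlonglongrightarrow> (if r = 0 then 1 else 0)" for r
    proof (induction r rule: less_induct)
      case (less r)
      consider "r = 0" | "r = 1" | s where "r = Suc (Suc s)" by (metis One_nat_def not0_implies_Suc)
      then show ?case
      proof cases
        case 1
        then show ?thesis by (simp add: I0)
      next
        case 2
        then show ?thesis using F[of 1] F1 by simp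
      next
        case (3 s)
        have "(\<lambda>n. F n (Suc (Suc s)) + I n s * inverse (real (q n))) \<longlonglongrightarrow>
            0 + (if s = 0 then 1 else 0) * 0"
          by (intro tendsto_intros F less q0) (simp_all add: 3)
        then show ?thesis unfolding 3 F_step by (simp add: divide_inverse)
      qed
    qed
    show ?iii
    proof
      fix P
      show "(\<lambda>n. \<integral>x. poly P x \<partial>\<mu> n) \<longlonglongrightarrow> (\<integral>x. poly P x \<partial>semicircle)"
        by (rule moment_conv_cheb_U[OF intM intN])
          (simp only: integral_semicircle_cheb_U I[unfolded I_def])
    qed
  qed
  moreover have "?iv" if v: ?v
  proof -
    have "(\<lambda>n. C n r) \<longlonglongrightarrow> 0" if "r \<ge> 1" for r
    proof (rule tendsto_sandwich[of "\<lambda>_. 0" _ _ "\<lambda>n. F n r"])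
      show "(\<lambda>n. F n r) \<longlonglongrightarrow> 0" using v that by blast
    qed (use bounds in auto)
    then show ?iv using v by blast
  qed
  moreover have "?v" if iv: ?iv
  proof -
    have C: "(\<lambda>n. C n r) \<longlonglongrightarrow> 0" if "r \<ge> 1" for r using iv that by blast
    have "(\<lambda>n. F n r) \<longlonglongrightarrow> 0" if "r \<ge> 1" for r
      using that
    proof (induction r rule: nat_induct_step2)
      case 1
      show ?case unfolding bounds(4) by (rule C) simp
    next
      case 2
      show ?case unfolding bounds(5) by (rule C) simp
    next
      case (step r)
      have "(\<lambda>n. C n (r + 2) + 2 * F n r) \<longlonglongrightarrow> 0 + 2 * 0"
        by (intro tendsto_intros C step) simp
      then show ?case
        by (intro tendsto_sandwich[of "\<lambda>_. 0" "\<lambda>n. F n (r + 2)" _ "\<lambda>n. C n (r + 2) + 2 * F n r"])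
          (use bounds(1) bounds(6)[OF step(1)] in auto)
    qed
    then show ?v using iv by blast
  qed
  ultimately have "(?i \<longleftrightarrow> ?ii) \<and> (?ii \<longleftrightarrow> ?iii) \<and> (?iii \<longleftrightarrow> ?iv) \<and> (?iv \<longleftrightarrow> ?v)"
    by argo
  then show ?thesis unfolding F_def C_def .
qed

end
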